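(* Let $(\mathbb T^{2n},\omega)$ be the torus with the standard symplectic form $\omega$, and let $\rho$ be a $\chi$-invariant Finsler metric on $\mathrm{Ham}(\mathbb T^{2n},\omega)$, i.e. a Finsler metric induced by a $\chi$-invariant norm $\|\cdot\|$ on $\mathcal A$. Then $\rho$ does not extend to a bi-invariant metric on $\mathrm{Symp}_0(\mathbb T^{2n},\omega)$.
   Context: $\mathbb T^{2n}=\mathbb R^{2n}/\mathbb Z^{2n}$ with coordinates $(x_1,\dots,x_n;y_1,\dots,y_n)$ and $\omega=\sum_i dx_i\wedge dy_i$. For a closed symplectic manifold $(M,\omega)$ of dimension $2n$, $\mathrm{Symp}_0(M,\omega)$ is the identity component of the symplectomorphism group and $\mathrm{Ham}(M,\omega)$ its subgroup of Hamiltonian symplectomorphisms (time-1 maps of flows of time-dependent smooth Hamiltonians). $\mathcal A$ is the space of normalized smooth functions on $M$: $\int_M F\,\omega^n=0$. Finsler metrics: a norm $\|\cdot\|$ on $\mathcal A$ defines the length $\int_0^1\|F_t\|\,dt$ of a smooth path $\alpha:[0,1]\to \mathrm{Ham}(M,\omega)$ generated by the time-dependent Hamiltonian $F_t\in\mathcal A$; $d(f,g)$ is the infimum of lengths of Hamiltonian paths connecting $f$ and $g$ (a pseudo-distance), and $\rho(f)=d(id,f)$. If $d$ is non-degenerate (a genuine metric), $\rho$ (equivalently $d$) is called the Finsler metric induced by $\|\cdot\|$. $\chi$-invariance: for $H\in\mathcal A$ define $\chi_H:(-\infty,+\infty)\to[0,1]$ by $$\chi_H(c)=\frac{\mathrm{vol}(\{p\in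 M\mid H(p)<c\},\omega)}{\mathrm{vol}(M,\omega)},$$ where volume is taken with respect to $\omega^n$. A norm $\|\cdot\|$ on $\mathcal A$ is $\chi$-invariant if $\|F\|=\|G\|$ whenever $\chi_F=\chi_G$. (Such a norm is invariant under composition with Hamiltonian symplectomorphisms, so the induced Finsler metric is bi-invariant.) A (real-valued) metric $d$ on a group $G$ is bi-invariant if $d(\theta\phi,\theta\psi)=d(\phi\theta,\psi\theta)=d(\phi,\psi)$ for all $\phi,\psi,\theta\in G$; it is identified with the function $\rho(f)=d(id,f)$. A metric on $\mathrm{Ham}$ extends to a bi-invariant metric on $\mathrm{Symp}_0$ if it is the restriction of a bi-invariant metric on $\mathrm{Symp}_0$. *)

theory Defs
  imports "HOL-Analysis.Analysis"
begin

primrec times_differentiable :: "nat \<Rightarrow> ('a::euclidean_space \<Rightarrow> 'b::real_normed_vector) \<Rightarrow> bool"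
where
  "times_differentiable 0 f \<longleftrightarrow> continuous_on UNIV f"
| "times_differentiable (Suc k) f \<longleftrightarrow> (\<forall>x. f differentiable (at x)) \<and>
     (\<forall>v. times_differentiable k (\<lambda>x. frechet_derivative f (at x) v))"

definition smooth :: "('a::euclidean_space \<Rightarrow> 'b::real_normed_vector) \<Rightarrow> bool" where
  "smooth f \<longleftrightarrow> (\<forall>k. times_differentiable k f)"

primrec iterated_deriv :: "'a list \<Rightarrow> ('a::euclidean_space \<Rightarrow> 'b::real_normed_vector) \<Rightarrow> 'a \<Rightarrow> 'b"
where
  "iterated_deriv [] f = f"
| "iterated_deriv (v # vs) f = iterated_deriv vs (\<lambda>x. frechet_derivative f (at x) v)"

text \<open>The vector \<open>(x, y)\<close> has the coordinates \<open>x $ i\<close>, \<open>y $ i\<close>, where \<open>n = CARD('n)\<close>.\<close>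

type_synonym 'n phase_space = "(real ^ 'n) \<times> (real ^ 'n)"

definition lattice_rel :: "'n::finite phase_space \<Rightarrow> 'n phase_space \<Rightarrow> bool" where
  "lattice_rel z w \<longleftrightarrow> (\<forall>i. fst z $ i - fst w $ i \<in> \<int> \<and> snd z $ i - snd w $ i \<in> \<int>)"

lemma equivp_lattice_rel: "equivp lattice_rel"
proof (rule equivpI)
  show "reflp lattice_rel"
    by (simp add: reflp_def lattice_rel_def)
  show "symp lattice_rel"
    unfolding symp_def lattice_rel_def by (metis Ints_minus minus_diff_eq)
  show "transp lattice_rel"
  proof (rule transpI)
    fix a b c :: "'b phase_space"
    assume ab: "lattice_rel a b" and bc: "lattice_rel b c"
    show "lattice_rel a c"
      unfolding lattice_rel_def
    proof (intro allI conjI)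
      fix i
      have "(fst a $ i - fst b $ i) + (fst b $ i - fst c $ i) \<in> \<int>"
        using ab bc unfolding lattice_rel_def by (intro Ints_add) auto
      then show "fst a $ i - fst c $ i \<in> \<int>" by simp
      have "(snd a $ i - snd b $ i) + (snd b $ i - snd c $ i) \<in> \<int>"
        using ab bc unfolding lattice_rel_def by (intro Ints_add) auto
      then show "snd a $ i - snd c $ i \<in> \<int>" by simp
    qed
  qed
qed

quotient_type 'n torus = "('n::finite) phase_space" / lattice_rel
  morphisms torus_rep torus_proj
  by (rule equivp_lattice_rel)

instantiation torus :: (finite) topological_space
begin

definition open_torus :: "'a torus set \<Rightarrow> bool" where
  "open_torus U \<longleftrightarrow> open (torus_proj -` U)"

instance
  by standard (auto simp: open_torus_def vimage_Union)

end

text \<open>\<open>\<omega> = \<Sum>\<^sub>i dx\<^sub>i \<and> dy\<^sub>i\<close> on tangent vectors; it has constant coefficients, so no base point.\<close>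

definition omega :: "'n::finite phase_space \<Rightarrow> 'n phase_space \<Rightarrow> real" where
  "omega u v = (\<Sum>i\<in>UNIV. fst u $ i * snd v $ i - fst v $ i * snd u $ i)"

text \<open>The volume form is \<open>\<omega>\<^sup>n = n! dx\<^sub>1 \<and> dy\<^sub>1 \<and> \<dots> \<and> dx\<^sub>n \<and> dy\<^sub>n\<close>.\<close>

definition unit_cube :: "'n::finite phase_space set" where
  "unit_cube = {z. \<forall>i. 0 \<le> fst z $ i \<and> fst z $ i < 1 \<and> 0 \<le> snd z $ i \<and> snd z $ i < 1}"

definition torus_vol :: "'n::finite torus measure" where
  "torus_vol = distr (scale_measure (fact CARD('n)) (restrict_space lborel unit_cube)) borel torus_proj"

definition normalized_functions :: "('n::finite torus \<Rightarrow> real) set" where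
  "normalized_functions = {F. smooth (\<lambda>z. F (torus_proj z)) \<and> integral\<^sup>L torus_vol F = 0}"

definition chi :: "('n::finite torus \<Rightarrow> real) \<Rightarrow> real \<Rightarrow> real" where
  "chi H c = measure torus_vol {p. H p < c} / measure torus_vol (UNIV :: 'n torus set)"

definition is_norm :: "(('n::finite torus \<Rightarrow> real) \<Rightarrow> real) \<Rightarrow> bool" where
  "is_norm N \<longleftrightarrow>
     (\<forall>F\<in>normalized_functions. 0 \<le> N F \<and> (N F = 0 \<longleftrightarrow> F = (\<lambda>p. 0))) \<and>
     (\<forall>F\<in>normalized_functions. \<forall>c. N (\<lambda>p. c * F p) = \<bar>c\<bar> * N F) \<and>
     (\<forall>F\<in>normalized_functions. \<forall>G\<in>normalized_functions. N (\<lambda>p. F p + G p) \<le> N F + N G)"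

definition chi_invariant :: "(('n::finite torus \<Rightarrow> real) \<Rightarrow> real) \<Rightarrow> bool" where
  "chi_invariant N \<longleftrightarrow>
     (\<forall>F\<in>normalized_functions. \<forall>G\<in>normalized_functions. chi F = chi G \<longrightarrow> N F = N G)"

text \<open>
  A map of the torus is smooth iff it is covered by a smooth map of \<open>\<real>\<^sup>2\<^sup>n\<close>
  (a global one exists because \<open>\<real>\<^sup>2\<^sup>n\<close> is simply connected).
\<close>

definition smooth_lift :: "('n::finite phase_space \<Rightarrow> 'n phase_space) \<Rightarrow> ('n torus \<Rightarrow> 'n torus) \<Rightarrow> bool"
where
  "smooth_lift \<Phi> \<phi> \<longleftrightarrow> smooth \<Phi> \<and> (\<forall>z. \<phi> (torus_proj z) = torus_proj (\<Phi> z))"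

definition Symp :: "('n::finite torus \<Rightarrow> 'n torus) set" where
  "Symp = {\<phi>. bij \<phi> \<and> (\<exists>\<Psi>. smooth_lift \<Psi> (inv \<phi>)) \<and>
     (\<exists>\<Phi>. smooth_lift \<Phi> \<phi> \<and>
        (\<forall>z u v. omega (frechet_derivative \<Phi> (at z) u) (frechet_derivative \<Phi> (at z) v) = omega u v))}"

definition Ck_close ::
  "nat \<Rightarrow> real \<Rightarrow> ('n::finite torus \<Rightarrow> 'n torus) \<Rightarrow> ('n torus \<Rightarrow> 'n torus) \<Rightarrow> bool"
where
  "Ck_close k \<epsilon> \<phi> \<psi> \<longleftrightarrow> (\<exists>\<Phi> \<Psi>. smooth_lift \<Phi> \<phi> \<and> smooth_lift \<Psi> \<psi> \<and>
     (\<forall>vs z. set vs \<subseteq> Basis \<and> length vs \<le> k \<longrightarrow>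
        norm (iterated_deriv vs \<Phi> z - iterated_deriv vs \<Psi> z) < \<epsilon>))"

definition Symp_open :: "('n::finite torus \<Rightarrow> 'n torus) set \<Rightarrow> bool" where
  "Symp_open U \<longleftrightarrow> U \<subseteq> Symp \<and>
     (\<forall>\<phi>\<in>U. \<exists>k. \<exists>\<epsilon>>0. \<forall>\<psi>\<in>Symp. Ck_close k \<epsilon> \<phi> \<psi> \<longrightarrow> \<psi> \<in> U)"

lemma Ck_close_mono:
  assumes "Ck_close k \<epsilon> \<phi> \<psi>" "j \<le> k" "\<epsilon> \<le> \<delta>"
  shows "Ck_close j \<delta> \<phi> \<psi>"
  using assms unfolding Ck_close_def by (meson less_le_trans order_trans)

lemma istopology_Symp_open: "istopology Symp_open"
  unfolding istopology_def
proof (intro conjI allI impI)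
  fix S T :: "('a torus \<Rightarrow> 'a torus) set"
  assume S: "Symp_open S" and T: "Symp_open T"
  show "Symp_open (S \<inter> T)"
    unfolding Symp_open_def
  proof (intro conjI ballI)
    show "S \<inter> T \<subseteq> Symp" using S unfolding Symp_open_def by blast
    fix \<phi> assume "\<phi> \<in> S \<inter> T"
    then obtain k \<epsilon> l \<delta> where "\<epsilon> > 0" "\<delta> > 0"
      and k: "\<forall>\<psi>\<in>Symp. Ck_close k \<epsilon> \<phi> \<psi> \<longrightarrow> \<psi> \<in> S"
      and l: "\<forall>\<psi>\<in>Symp. Ck_close l \<delta> \<phi> \<psi> \<longrightarrow> \<psi> \<in> T"
      using S T unfolding Symp_open_def by (metis IntD1 IntD2)
    have "\<forall>\<psi>\<in>Symp. Ck_close (max k l) (min \<epsilon> \<delta>) \<phi> \<psi> \<longrightarrow> \<psi> \<in> S \<inter> T"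
      using k l by (metis Ck_close_mono IntI max.cobounded1 max.cobounded2
          min.cobounded1 min.cobounded2)
    moreover have "min \<epsilon> \<delta> > 0" using \<open>\<epsilon> > 0\<close> \<open>\<delta> > 0\<close> by simp
    ultimately show "\<exists>k. \<exists>\<epsilon>>0. \<forall>\<psi>\<in>Symp. Ck_close k \<epsilon> \<phi> \<psi> \<longrightarrow> \<psi> \<in> S \<inter> T" by blast
  qed
next
  fix \<K> :: "('a torus \<Rightarrow> 'a torus) set set"
  assume "\<forall>K\<in>\<K>. Symp_open K"
  then show "Symp_open (\<Union>\<K>)"
    unfolding Symp_open_def by (meson Union_iff Union_least)
qed

definition Symp_topology :: "('n::finite torus \<Rightarrow> 'n torus) topology" where
  "Symp_topology = topology Symp_open"

lemma openin_Symp_topology: "openin Symp_topology U \<longleftrightarrow> Symp_open U"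
  by (simp add: Symp_topology_def topology_inverse' istopology_Symp_open)

lemma topspace_Symp_topology: "topspace Symp_topology = Symp"
proof -
  have "Symp_open Symp"
    unfolding Symp_open_def using zero_less_one by blast
  then show ?thesis
    unfolding topspace_def openin_Symp_topology by (auto simp: Symp_open_def)
qed

definition Symp0 :: "('n::finite torus \<Rightarrow> 'n torus) set" where
  "Symp0 = connected_component_of_set Symp_topology id"

text \<open>
  \<open>X\<close> is the value at \<open>torus_proj z\<close> of the Hamiltonian vector field of \<open>H\<close>, with the convention
  \<open>\<omega>(X, \<cdot>) = dH\<close>. The opposite sign gives the same Hamiltonian maps and the same lengths.
\<close>

definition is_ham_vector ::
  "('n::finite torus \<Rightarrow> real) \<Rightarrow> 'n phase_space \<Rightarrow> 'n phase_space \<Rightarrow> bool"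
where
  "is_ham_vector H z X \<longleftrightarrow> (\<forall>v. omega X v = frechet_derivative (\<lambda>w. H (torus_proj w)) (at z) v)"

text \<open>
  Paths are parametrized by \<open>[0,1]\<close>. Smoothness on \<open>[0,1] \<times> M\<close> means the existence of a smooth
  extension to \<open>\<real> \<times> M\<close>, so \<open>F\<close> and the lift \<open>A\<close> of the path are given for all real times, but
  only their restrictions to \<open>[0,1]\<close> matter.
\<close>

definition generates ::
  "(real \<Rightarrow> 'n::finite torus \<Rightarrow> real) \<Rightarrow> (real \<Rightarrow> 'n torus \<Rightarrow> 'n torus) \<Rightarrow> bool"
where
  "generates F \<alpha> \<longleftrightarrow> smooth (\<lambda>(t, z). F t (torus_proj z)) \<and>
     (\<exists>A :: real \<times> 'n phase_space \<Rightarrow> 'n phase_space. smooth A \<and>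
        (\<forall>t\<in>{0..1}. \<forall>z. \<alpha> t (torus_proj z) = torus_proj (A (t, z)) \<and>
           is_ham_vector (F t) (A (t, z)) (vector_derivative (\<lambda>s. A (s, z)) (at t))))"

definition Ham :: "('n::finite torus \<Rightarrow> 'n torus) set" where
  "Ham = {\<alpha> 1 | F \<alpha>. generates F \<alpha> \<and> \<alpha> 0 = id}"

text \<open>
  A norm on \<open>normalized_functions\<close> is not assumed continuous in any topology; only paths whose
  length \<open>\<integral>\<^sub>0\<^sup>1 \<parallel>F\<^sub>t\<parallel> dt\<close> is defined enter the infimum.
\<close>

definition path_length ::
  "(('n::finite torus \<Rightarrow> real) \<Rightarrow> real) \<Rightarrow> (real \<Rightarrow> 'n torus \<Rightarrow> real) \<Rightarrow> real"
where
  "path_length N F = integral {0..1} (\<lambda>t. N (F t))"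

definition finsler_dist ::
  "(('n::finite torus \<Rightarrow> real) \<Rightarrow> real) \<Rightarrow> ('n torus \<Rightarrow> 'n torus) \<Rightarrow> ('n torus \<Rightarrow> 'n torus) \<Rightarrow> real"
where
  "finsler_dist N f g = Inf {path_length N F | F \<alpha>.
     generates F \<alpha> \<and> (\<forall>t\<in>{0..1}. \<alpha> t \<in> Ham \<and> F t \<in> normalized_functions) \<and>
     \<alpha> 0 = f \<and> \<alpha> 1 = g \<and> (\<lambda>t. N (F t)) integrable_on {0..1}}"

definition nondegenerate_on :: "'a set \<Rightarrow> ('a \<Rightarrow> 'a \<Rightarrow> real) \<Rightarrow> bool" where
  "nondegenerate_on G d \<longleftrightarrow> (\<forall>f\<in>G. \<forall>g\<in>G. d f g = 0 \<longrightarrow> f = g)"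

definition biinvariant_metric :: "('a \<Rightarrow> 'a) set \<Rightarrow> (('a \<Rightarrow> 'a) \<Rightarrow> ('a \<Rightarrow> 'a) \<Rightarrow> real) \<Rightarrow> bool"
where
  "biinvariant_metric G d \<longleftrightarrow> Metric_space G d \<and>
     (\<forall>\<phi>\<in>G. \<forall>\<psi>\<in>G. \<forall>\<theta>\<in>G. d (\<theta> \<circ> \<phi>) (\<theta> \<circ> \<psi>) = d \<phi> \<psi> \<and> d (\<phi> \<circ> \<theta>) (\<psi> \<circ> \<theta>) = d \<phi> \<psi>)"

definition extends_biinvariantly ::
  "('a \<Rightarrow> 'a) set \<Rightarrow> ('a \<Rightarrow> 'a) set \<Rightarrow> (('a \<Rightarrow> 'a) \<Rightarrow> ('a \<Rightarrow> 'a) \<Rightarrow> real) \<Rightarrow> bool"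
where
  "extends_biinvariantly H G d \<longleftrightarrow>
     (\<exists>D. biinvariant_metric G D \<and> (\<forall>f\<in>H. \<forall>g\<in>H. D f g = d f g))"

end

theory Submission
  imports Defs
begin

text \<open>
  Let \<open>D\<close> be a bi-invariant extension and write \<open>r g = D(id, g)\<close>. All maps used are shears
  \<open>z \<mapsto> z + f(\<omega>(e, z)) e\<close> with an integral vector \<open>e\<close> and a 1-periodic function \<open>f\<close>; translations are
  the case of constant \<open>f\<close>. For antiperiodic \<open>v\<close>, i.e. \<open>v(t + 1/2) = - v(t)\<close>, the shear \<open>x \<mapsto> x + c v(y)\<close>
  is a commutator of a shear and the translation \<open>y \<mapsto> y + 1/2\<close>, so \<open>r\<close> is bounded on these
  shears uniformly in \<open>c\<close>. Pulling a Hamiltonian back along the covering \<open>z \<mapsto> k z\<close> preserves \<open>\<chi>\<close>, and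
  dividing it by \<open>k\<^sup>2\<close> makes it generate the lifted flow; hence \<open>r = O(1/k\<^sup>2)\<close> for
  \<open>x \<mapsto> x + w(k y)\<close>, where \<open>w\<close> is antiperiodic with values \<open>\<plusminus>1/2\<close> outside short intervals.

  Modulo 1 this fast shear is the translation \<open>x \<mapsto> x + 1/2\<close> except on thin strips. Therefore a slow shear
  \<open>g\<close> in the \<open>y\<close>-direction, split into \<open>O(k)\<close> equal factors, is \<open>O(1/k)\<close>-close both to a map supported near
  these strips and to one supported near the strips shifted by a quarter period. A conjugate
  \<open>h = \<sigma> g \<sigma>\<inverse>\<close> by a shear \<open>\<sigma>\<close> in the \<open>x\<close>-direction, which preserves the strips, is then close to a map that
  commutes with an approximation of \<open>g\<close>. So \<open>D(gh, hg) = O(1/k)\<close> for all \<open>k\<close>, i.e. \<open>gh = hg\<close>, which is false.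
\<close>

section \<open>Smooth functions\<close>

lemma times_differentiable_SucD:
  assumes "times_differentiable (Suc k) f" shows "times_differentiable k f"
  using assms
proof (induction k arbitrary: f)
  case 0
  then show ?case
    by (auto intro!: continuous_at_imp_continuous_on differentiable_imp_continuous_within)
next
  case (Suc k)
  then show ?case by (metis times_differentiable.simps(2))
qed

text \<open>Derivatives are unique, so any explicit formula \<open>f'\<close> may stand in for
  \<open>frechet_derivative f\<close>; the rules below all supply such a formula.\<close>

lemma times_differentiable_SucI:
  assumes "\<And>x. (f has_derivative f' x) (at x)" "\<And>v. times_differentiable k (\<lambda>x. f' x v)"
  shows "times_differentiable (Suc k) f"
  using assms frechet_derivative_at[OF assms(1)]
  by (auto simp: differentiable_def)

lemma times_differentiable_has_derivative:
  "times_differentiable (Suc k) f \<Longrightarrow> (f has_derivative frechet_derivative f (at x)) (at x)"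
  by (simp add: frechet_derivative_works)

lemma times_differentiable_continuous: "times_differentiable k f \<Longrightarrow> continuous_on UNIV f"
proof (induction k)
  case (Suc k)
  then show ?case using times_differentiable_SucD by blast
qed simp

lemma times_differentiable_const: "times_differentiable k (\<lambda>x. c)"
proof (induction k arbitrary: c)
  case (Suc k)
  show ?case by (rule times_differentiable_SucI[OF has_derivative_const]) (rule Suc)
qed simp

lemma times_differentiable_linear:
  "bounded_linear f \<Longrightarrow> times_differentiable k f"
  by (cases k) (simp_all only: times_differentiable.simps(1) linear_continuous_on
      times_differentiable_SucI[OF bounded_linear_imp_has_derivative times_differentiable_const])

lemma times_differentiable_bounded_linear:
  assumes "bounded_linear L" "times_differentiable k f"
  shows "times_differentiable k (\<lambda>x. L (f x))"
  using assms(2)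
proof (induction k arbitrary: f)
  case 0
  then show ?case using assms(1) by (simp add: bounded_linear.continuous_on)
next
  case (Suc k)
  show ?case
    by (rule times_differentiable_SucI[OF bounded_linear.has_derivative[OF assms(1)
            times_differentiable_has_derivative[OF Suc.prems]]]) (use Suc in auto)
qed

lemma times_differentiable_add:
  "times_differentiable k f \<Longrightarrow> times_differentiable k g \<Longrightarrow> times_differentiable k (\<lambda>x. f x + g x)"
proof (induction k arbitrary: f g)
  case 0
  then show ?case by (simp add: continuous_on_add)
next
  case (Suc k)
  show ?case
    by (rule times_differentiable_SucI[OF has_derivative_add[OF
            times_differentiable_has_derivative[OF Suc.prems(1)]
            times_differentiable_has_derivative[OF Suc.prems(2)]]]) (use Suc in auto)
qed

lemma times_differentiable_sum:
  "(\<And>i. i \<in> I \<Longrightarrow> times_differentiable k (f i)) \<Longrightarrow> times_differentiable k (\<lambda>x. \<Sum>i\<in>I. f i x)"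
  by (induction I rule: infinite_finite_induct)
     (auto intro!: times_differentiable_add times_differentiable_const)

lemma times_differentiable_bilinear:
  assumes "bounded_bilinear B"
  shows "times_differentiable k f \<Longrightarrow> times_differentiable k g \<Longrightarrow> times_differentiable k (\<lambda>x. B (f x) (g x))"
proof (induction k arbitrary: f g)
  case 0
  then show ?case using assms by (simp add: bounded_bilinear.continuous_on)
next
  case (Suc k)
  show ?case
  proof (rule times_differentiable_SucI[OF bounded_bilinear.FDERIV[OF assms
            times_differentiable_has_derivative[OF Suc.prems(1)]
            times_differentiable_has_derivative[OF Suc.prems(2)]]])
    show "times_differentiable k (\<lambda>x. B (f x) (frechet_derivative g (at x) v)
        + B (frechet_derivative f (at x) v) (g x))" for v
      using Suc.prems times_differentiable_SucD[OF Suc.prems(1)] times_differentiable_SucD[OF Suc.prems(2)]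
      by (intro times_differentiable_add Suc.IH) auto
  qed
qed

text \<open>The chain rule gives the derivative of \<open>f\<close> at \<open>g x\<close> applied to
  a vector that itself depends on \<open>x\<close>. Expanding this vector in the standard basis
  leaves sums of products of scalar functions with directional derivatives of \<open>f\<close>
  composed with \<open>g\<close>, to which the induction hypothesis applies.\<close>

lemma times_differentiable_compose:
  fixes f :: "'b::euclidean_space \<Rightarrow> 'c::real_normed_vector" and g :: "'a::euclidean_space \<Rightarrow> 'b"
  shows "times_differentiable k f \<Longrightarrow> times_differentiable k g \<Longrightarrow> times_differentiable k (\<lambda>x. f (g x))"
proof (induction k arbitrary: f g)
  case 0
  then show ?case by (auto intro: continuous_on_compose2)
next
  case (Suc k)
  have *: "frechet_derivative f (at y) w = (\<Sum>b\<in>Basis. (w \<bullet> b) *\<^sub>R frechet_derivative f (at y) b)" for y w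
  proof -
    have lin: "linear (frechet_derivative f (at y))"
      using times_differentiable_has_derivative[OF Suc.prems(1), of y] has_derivative_linear by blast
    have "frechet_derivative f (at y) w = frechet_derivative f (at y) (\<Sum>b\<in>Basis. (w \<bullet> b) *\<^sub>R b)"
      by (simp add: euclidean_representation)
    then show ?thesis
      by (simp add: linear_sum[OF lin] linear_scale[OF lin])
  qed
  show ?case
  proof (rule times_differentiable_SucI)
    show "((\<lambda>x. f (g x)) has_derivative (\<lambda>v. \<Sum>b\<in>Basis. (frechet_derivative g (at x) v \<bullet> b) *\<^sub>R
              frechet_derivative f (at (g x)) b)) (at x)" for x
      using diff_chain_at[OF times_differentiable_has_derivative[OF Suc.prems(2), of x]
          times_differentiable_has_derivative[OF Suc.prems(1)]]
      unfolding o_def by (subst (asm) *)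
    show "times_differentiable k (\<lambda>x. \<Sum>b\<in>Basis. (frechet_derivative g (at x) v \<bullet> b) *\<^sub>R
              frechet_derivative f (at (g x)) b)" for v
      using Suc.prems times_differentiable_SucD[OF Suc.prems(2)]
      by (intro times_differentiable_sum times_differentiable_bilinear[OF bounded_bilinear_scaleR]
          times_differentiable_bounded_linear[OF bounded_linear_inner_left] Suc.IH) auto
  qed
qed

lemma times_differentiable_real:
  fixes f :: "real \<Rightarrow> real"
  assumes "\<And>x. (f has_real_derivative f' x) (at x)" "times_differentiable k f'"
  shows "times_differentiable (Suc k) f"
proof (rule times_differentiable_SucI)
  show "(f has_derivative (*) (f' x)) (at x)" for x
    using assms(1) by (simp add: has_field_derivative_def)
  show "times_differentiable k (\<lambda>x. f' x * v)" for v
    using times_differentiable_bounded_linear[OF bounded_linear_mult_left assms(2)] .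
qed

named_theorems smooth_intros

lemma smooth_const [smooth_intros]: "smooth (\<lambda>x. c)"
  by (simp add: smooth_def times_differentiable_const)

lemma smooth_linear: "bounded_linear f \<Longrightarrow> smooth f"
  by (simp add: smooth_def times_differentiable_linear)

lemma smooth_ident [smooth_intros]: "smooth (\<lambda>x. x)"
  by (rule smooth_linear[OF bounded_linear_ident])

lemma smooth_bounded_linear: "bounded_linear L \<Longrightarrow> smooth f \<Longrightarrow> smooth (\<lambda>x. L (f x))"
  by (simp add: smooth_def times_differentiable_bounded_linear)

lemma smooth_add [smooth_intros]: "smooth f \<Longrightarrow> smooth g \<Longrightarrow> smooth (\<lambda>x. f x + g x)"
  by (simp add: smooth_def times_differentiable_add)

lemma smooth_bilinear: "bounded_bilinear B \<Longrightarrow> smooth f \<Longrightarrow> smooth g \<Longrightarrow> smooth (\<lambda>x. B (f x) (g x))"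
  by (simp add: smooth_def times_differentiable_bilinear)

lemmas smooth_scaleR [smooth_intros] = smooth_bilinear[OF bounded_bilinear_scaleR]
lemmas smooth_mult [smooth_intros] = smooth_bilinear[OF bounded_bilinear_mult]
lemmas smooth_fst [smooth_intros] = smooth_bounded_linear[OF bounded_linear_fst]
lemmas smooth_snd [smooth_intros] = smooth_bounded_linear[OF bounded_linear_snd]
lemmas smooth_minus [smooth_intros] = smooth_bounded_linear[OF bounded_linear_minus[OF bounded_linear_ident]]

lemma smooth_diff [smooth_intros]: "smooth f \<Longrightarrow> smooth g \<Longrightarrow> smooth (\<lambda>x. f x - g x)"
  using smooth_add[OF _ smooth_minus] by simp

lemma smooth_Pair [smooth_intros]:
  assumes "smooth f" "smooth g" shows "smooth (\<lambda>x. (f x, g x))"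
proof -
  have "smooth (\<lambda>x. (f x, 0) + (0, g x))"
    by (intro smooth_add smooth_bounded_linear[OF _ assms(1)] smooth_bounded_linear[OF _ assms(2)]
        bounded_linear_Pair bounded_linear_ident bounded_linear_zero)
  then show ?thesis by simp
qed

lemma smooth_compose: "smooth f \<Longrightarrow> smooth g \<Longrightarrow> smooth (\<lambda>x. f (g x))"
  by (simp add: smooth_def times_differentiable_compose)

lemma smooth_continuous: "smooth f \<Longrightarrow> continuous_on UNIV f"
  unfolding smooth_def using times_differentiable_continuous by blast

lemma smooth_differentiable: "smooth f \<Longrightarrow> f differentiable (at x)"
  unfolding smooth_def using times_differentiable.simps(2) by blast

lemma smooth_has_derivative: "smooth f \<Longrightarrow> (f has_derivative frechet_derivative f (at x)) (at x)"
  using smooth_differentiable frechet_derivative_works by blast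

lemma smooth_frechet_derivative: "smooth f \<Longrightarrow> smooth (\<lambda>x. frechet_derivative f (at x) v)"
  unfolding smooth_def using times_differentiable.simps(2) by blast

lemma smooth_real:
  fixes f :: "real \<Rightarrow> real"
  assumes "\<And>x. (f has_real_derivative f' x) (at x)" "smooth f'"
  shows "smooth f"
  unfolding smooth_def
proof
  fix k show "times_differentiable k f"
    using times_differentiable_SucD[OF times_differentiable_real[OF assms(1)]] assms(2)
    unfolding smooth_def by blast
qed

text \<open>The derivative of the inverse is, up to sign, the derivative of \<open>f\<close> times
  two copies of the inverse, so each order of differentiability yields the next.\<close>

lemma smooth_inverse:
  fixes f :: "'a::euclidean_space \<Rightarrow> real"
  assumes "smooth f" "\<And>x. f x \<noteq> 0"
  shows "smooth (\<lambda>x. inverse (f x))"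
  unfolding smooth_def
proof
  fix k show "times_differentiable k (\<lambda>x. inverse (f x))"
  proof (induction k)
    case 0
    then show ?case using assms smooth_continuous by (auto intro!: continuous_intros)
  next
    case (Suc k)
    show ?case
    proof (rule times_differentiable_SucI[OF Deriv.has_derivative_inverse[OF assms(2) smooth_has_derivative[OF assms(1)]]])
      show "times_differentiable k (\<lambda>x. - (inverse (f x) * frechet_derivative f (at x) v * inverse (f x)))" for v
        using Suc smooth_frechet_derivative[OF assms(1)] unfolding smooth_def
        by (intro times_differentiable_bounded_linear[OF bounded_linear_minus[OF bounded_linear_ident]]
            times_differentiable_bilinear[OF bounded_bilinear_mult]) auto
    qed
  qed
qed

lemma times_differentiable_sin_cos:
  "times_differentiable k (sin :: real \<Rightarrow> real) \<and> times_differentiable k (cos :: real \<Rightarrow> real)"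
proof (induction k)
  case 0
  then show ?case by (auto intro!: continuous_intros)
next
  case (Suc k)
  have "times_differentiable k (\<lambda>x. - sin x :: real)"
    using Suc by (intro times_differentiable_bounded_linear[OF bounded_linear_minus[OF bounded_linear_ident]]) auto
  with Suc show ?case
    by (auto intro: times_differentiable_real[OF DERIV_sin] times_differentiable_real[OF DERIV_cos]
        simp del: times_differentiable.simps)
qed

lemma smooth_sin: "smooth (sin :: real \<Rightarrow> real)" and smooth_cos: "smooth (cos :: real \<Rightarrow> real)"
  using times_differentiable_sin_cos unfolding smooth_def by auto

section \<open>Flat functions and a smooth odd step\<close>

text \<open>\<open>flat 0\<close> is the classical smooth function vanishing on the left half-line.
  The powers of \<open>inverse x\<close> are carried along so that the family is closed under
  differentiation up to linear combinations.\<close>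

definition flat :: "nat \<Rightarrow> real \<Rightarrow> real" where
  "flat m x = (if x > 0 then inverse x ^ m * exp (- inverse x) else 0)"

lemma flat_tendsto_0: "(flat m \<longlongrightarrow> 0) (at 0)"
proof -
  have 1: "((\<lambda>x::real. x ^ m / exp x) \<longlongrightarrow> 0) at_top"
    by (rule tendsto_power_div_exp_0)
  have "((\<lambda>x. inverse x ^ m * exp (- inverse x)) \<longlongrightarrow> 0) (at_right (0::real))"
    using filterlim_compose[OF 1 filterlim_inverse_at_top_right]
    by (simp add: exp_minus field_simps)
  then have "(flat m \<longlongrightarrow> 0) (at_right 0)"
    by (rule Lim_transform_eventually) (auto simp: eventually_at_filter flat_def)
  moreover have "(flat m \<longlongrightarrow> 0) (at_left 0)"
    by (rule tendsto_eventually) (auto simp: eventually_at_filter flat_def)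
  ultimately show ?thesis by (simp add: filterlim_at_split)
qed

lemma flat_has_derivative:
  "(flat m has_real_derivative flat (m + 2) x - real m * flat (m + 1) x) (at x)"
proof (cases x "0::real" rule: linorder_cases)
  case less
  have "((\<lambda>x. 0) has_real_derivative 0) (at x)" by simp
  moreover have "eventually (\<lambda>y. y < 0) (nhds x)"
    using less by (simp add: eventually_nhds) (meson lessThan_iff open_lessThan)
  ultimately show ?thesis
    using less by (subst DERIV_cong_ev[where g = "\<lambda>x. 0" and y = x, OF refl])
      (auto simp: flat_def elim: eventually_mono)
next
  case greater
  have ev: "eventually (\<lambda>y. y > 0) (nhds x)"
    using greater by (simp add: eventually_nhds) (meson greaterThan_iff open_greaterThan)
  have "((\<lambda>y. inverse y ^ m * exp (- inverse y)) has_real_derivative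
      flat (m + 2) x - real m * flat (m + 1) x) (at x)"
    using greater
    by (auto intro!: derivative_eq_intros simp: flat_def power2_eq_square)
       (cases m; simp add: field_simps)
  moreover have "eventually (\<lambda>y. flat m y = inverse y ^ m * exp (- inverse y)) (nhds x)"
    using ev by (rule eventually_mono) (simp add: flat_def)
  ultimately show ?thesis
    by (subst DERIV_cong_ev[OF refl _ refl])
next
  case equal
  \<comment> \<open>At the origin the difference quotient of \<open>flat m\<close> is
    \<open>flat (m + 1)\<close> itself, which tends to 0.\<close>
  have "(\<lambda>h. (flat m (0 + h) - flat m 0) / h) = flat (m + 1)"
    by (auto simp: flat_def fun_eq_iff field_simps)
  then have "(flat m has_real_derivative 0) (at 0)"
    using flat_tendsto_0 unfolding DERIV_def by simp
  then show ?thesis using equal by (simp add: flat_def)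
qed

lemma smooth_flat: "smooth (flat m)"
  unfolding smooth_def
proof
  fix k show "times_differentiable k (flat m)"
  proof (induction k arbitrary: m)
    case 0
    then show ?case
      by (auto intro!: continuous_at_imp_continuous_on DERIV_isCont flat_has_derivative)
  next
    case (Suc k)
    have "times_differentiable k (\<lambda>x. flat (m + 2) x + (- real m) * flat (m + 1) x)"
      using Suc by (intro times_differentiable_add times_differentiable_bounded_linear[OF bounded_linear_mult_right])
    then show ?case
      by (intro times_differentiable_real[OF flat_has_derivative]) simp
  qed
qed

text \<open>Dividing the difference of two mirrored flat functions by their sum gives an odd
  function. From 1/4 on one of the two vanishes, so the quotient is 1; the factor 1/2 rescales
  it.\<close>

lemma smooth_step_exists:
  obtains B :: "real \<Rightarrow> real" where "smooth B" "\<And>t. B (- t) = - B t"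
    "\<And>t. t \<ge> 1/4 \<Longrightarrow> B t = 1/2"
proof
  define D :: "real \<Rightarrow> real" where "D t = flat 0 (1/4 + t) + flat 0 (1/4 - t)" for t
  have pos: "D t > 0" for t
    by (auto simp: D_def flat_def add_pos_pos)
  let ?B = "\<lambda>t. (1/2) * (flat 0 (1/4 + t) - flat 0 (1/4 - t)) * inverse (D t)"
  have "smooth D" unfolding D_def by (intro smooth_intros smooth_compose[OF smooth_flat])
  then show "smooth ?B"
    using pos by (intro smooth_intros smooth_compose[OF smooth_flat] smooth_inverse) (auto simp: less_le)
  show "?B (- t) = - ?B t" for t
    using pos[of t] by (simp add: D_def divide_simps)
  show "?B t = 1/2" if "t \<ge> 1/4" for t
    using that by (simp add: D_def flat_def)
qed

section \<open>Shears of the torus\<close>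

declare split_paired_All [simp del] split_paired_Ex [simp del]

definition lattice :: "'n::finite phase_space set" where
  "lattice = {m. lattice_rel m 0}"

lemma lattice_iff: "m \<in> lattice \<longleftrightarrow> (\<forall>i. fst m $ i \<in> \<int> \<and> snd m $ i \<in> \<int>)"
  by (simp add: lattice_def lattice_rel_def)

lemma lattice_minus: "a \<in> lattice \<Longrightarrow> - a \<in> lattice"
  and lattice_scale: "a \<in> lattice \<Longrightarrow> c \<in> \<int> \<Longrightarrow> c *\<^sub>R a \<in> lattice"
  by (auto simp: lattice_iff)

lemma torus_proj_eq_iff: "torus_proj z = torus_proj w \<longleftrightarrow> z - w \<in> lattice"
  by (simp add: torus.abs_eq_iff lattice_rel_def lattice_iff)

lemma torus_proj_eqI: "z - w \<in> lattice \<Longrightarrow> torus_proj z = torus_proj w"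
  by (simp add: torus_proj_eq_iff)

lemma torus_proj_add: "m \<in> lattice \<Longrightarrow> torus_proj (z + m) = torus_proj z"
  by (simp add: torus_proj_eq_iff)

lemma torus_proj_rep: "torus_proj (torus_rep p) = p"
  by (rule Quotient3_abs_rep[OF Quotient3_torus])

lemma torus_eqI: "(\<And>z. f (torus_proj z) = g (torus_proj z)) \<Longrightarrow> f = g"
  by (metis ext torus_proj_rep)

lemma lattice_reduce:
  obtains m where "m \<in> lattice" "z + m \<in> unit_cube"
proof
  let ?m = "(\<chi> i. - of_int \<lfloor>fst z $ i\<rfloor>, \<chi> i. - of_int \<lfloor>snd z $ i\<rfloor>)"
  show "?m \<in> lattice" by (simp add: lattice_iff)
  have "x - of_int \<lfloor>x\<rfloor> < 1" for x :: real by linarith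
  then show "z + ?m \<in> unit_cube" by (simp add: unit_cube_def)
qed

text \<open>The value is computed from a chosen representative, which makes the map total. It is
  covered by \<open>\<Phi>\<close> when \<open>\<Phi>\<close> respects lattice equivalence.\<close>

definition torus_map :: "('n::finite phase_space \<Rightarrow> 'n phase_space) \<Rightarrow> 'n torus \<Rightarrow> 'n torus" where
  "torus_map \<Phi> p = torus_proj (\<Phi> (torus_rep p))"

lemma torus_map_proj:
  assumes "\<And>z m. m \<in> lattice \<Longrightarrow> \<Phi> (z + m) - \<Phi> z \<in> lattice"
  shows "torus_map \<Phi> (torus_proj z) = torus_proj (\<Phi> z)"
proof -
  have "torus_rep (torus_proj z) - z \<in> lattice"
    using torus_proj_rep torus_proj_eq_iff by metis
  from assms[OF this, of z] show ?thesis
    unfolding torus_map_def by (intro torus_proj_eqI) simp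
qed

text \<open>Such lifts commute with all deck translations, as lifts of maps isotopic to the identity
  do. The property survives composition and conjugation by an integral dilation.\<close>

definition equivariant :: "('n::finite phase_space \<Rightarrow> 'n phase_space) \<Rightarrow> bool" where
  "equivariant \<Phi> \<longleftrightarrow> (\<forall>z. \<forall>m\<in>lattice. \<Phi> (z + m) = \<Phi> z + m)"

lemma equivariant_torus_map: "equivariant \<Phi> \<Longrightarrow> torus_map \<Phi> (torus_proj z) = torus_proj (\<Phi> z)"
  by (rule torus_map_proj) (simp add: equivariant_def)

lemma bounded_bilinear_omega: "bounded_bilinear (omega :: 'n::finite phase_space \<Rightarrow> _)"
proof -
  have "bilinear (omega :: 'n phase_space \<Rightarrow> _)"
    unfolding bilinear_def omega_def
    by (auto intro!: linearI simp: algebra_simps sum.distrib sum_subtractf sum_distrib_left)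
  then show ?thesis by (simp add: bilinear_conv_bounded_bilinear)
qed

interpretation omega: bounded_bilinear "omega :: 'n::finite phase_space \<Rightarrow> _"
  by (rule bounded_bilinear_omega)

lemma omega_self [simp]: "omega u u = 0"
  by (simp add: omega_def mult.commute)

lemma omega_commute: "omega u v = - omega v u"
  by (simp add: omega_def sum_negf[symmetric] algebra_simps)

lemma omega_lattice: "u \<in> lattice \<Longrightarrow> v \<in> lattice \<Longrightarrow> omega u v \<in> \<int>"
  by (auto simp: omega_def lattice_iff)

definition profile :: "(real \<Rightarrow> real) \<Rightarrow> bool" where
  "profile f \<longleftrightarrow> smooth f \<and> (\<forall>t. f (t + 1) = f t)"

lemma profile_Ints:
  assumes "profile f" "n \<in> \<int>" shows "f (t + n) = f t"
proof -
  have nat: "f (t + of_nat k) = f t" for k t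
    using assms(1) by (induction k) (auto simp: profile_def add.assoc[symmetric] add.commute[of 1])
  from assms(2) obtain j where j: "n = of_int j" by (auto elim: Ints_cases)
  show ?thesis
  proof (cases "j \<ge> 0")
    case True then show ?thesis using nat[of t "nat j"] j by simp
  next
    case False then show ?thesis using nat[of "t + n" "nat (- j)"] j by simp
  qed
qed

lemma profile_const: "profile (\<lambda>_. c)"
  by (simp add: profile_def smooth_const)

lemma profile_add: "profile f \<Longrightarrow> profile g \<Longrightarrow> profile (\<lambda>t. f t + g t)"
  by (simp add: profile_def smooth_add)

lemma profile_scale: "profile f \<Longrightarrow> profile (\<lambda>t. c * f t)"
  by (simp add: profile_def smooth_mult smooth_const)

lemma profile_minus: "profile f \<Longrightarrow> profile (\<lambda>t. - f t)"
  by (simp add: profile_def smooth_minus)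

lemma profile_shift: "profile f \<Longrightarrow> profile (\<lambda>t. f (t + a))"
  using smooth_compose[of f "\<lambda>t. t + a"]
  by (simp add: profile_def smooth_add smooth_const smooth_ident add.assoc[symmetric] add.commute[of _ a])

lemma profile_rescale: 
  assumes "profile f" shows "profile (\<lambda>t. f (real k * t))"
  using assms profile_Ints[OF assms, of "real k"] smooth_compose[of f "\<lambda>t. real k * t"]
  by (simp add: profile_def smooth_mult smooth_const smooth_ident ring_distribs)

text \<open>If \<open>f\<close> is the derivative of \<open>V\<close>, this is the time-1 map of the
  Hamiltonian \<open>V (omega e z)\<close>. As \<open>omega e\<close> is constant in the direction
  \<open>e\<close>, profiles of shears with the same \<open>e\<close> add under composition.\<close>

definition shear :: "'n::finite phase_space \<Rightarrow> (real \<Rightarrow> real) \<Rightarrow> 'n phase_space \<Rightarrow> 'n phase_space" where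
  "shear e f z = z + f (omega e z) *\<^sub>R e"

definition tshear :: "'n::finite phase_space \<Rightarrow> (real \<Rightarrow> real) \<Rightarrow> 'n torus \<Rightarrow> 'n torus" where
  "tshear e f = torus_map (shear e f)"

lemma omega_shear [simp]: "omega e (shear e f z) = omega e z"
  by (simp add: shear_def omega.add_right omega.scaleR_right)

lemma shear_equivariant: "e \<in> lattice \<Longrightarrow> profile f \<Longrightarrow> equivariant (shear e f)"
  by (simp add: equivariant_def shear_def omega.add_right profile_Ints omega_lattice)

lemma tshear_proj: "e \<in> lattice \<Longrightarrow> profile f \<Longrightarrow> tshear e f (torus_proj z) = torus_proj (shear e f z)"
  unfolding tshear_def by (intro equivariant_torus_map shear_equivariant)

lemma tshear_comp:
  assumes "e \<in> lattice" "profile f" "profile g"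
  shows "tshear e f \<circ> tshear e g = tshear e (\<lambda>t. f t + g t)"
  using assms by (intro torus_eqI)
    (simp add: tshear_proj profile_add, simp add: shear_def omega.add_right omega.scaleR_right algebra_simps)

lemma tshear_0: "tshear e (\<lambda>_. 0) = id"
  by (simp add: tshear_def torus_map_def shear_def fun_eq_iff torus_proj_rep)

lemma tshear_inverse:
  assumes "e \<in> lattice" "profile f"
  shows "tshear e f \<circ> tshear e (\<lambda>t. - f t) = id" "tshear e (\<lambda>t. - f t) \<circ> tshear e f = id"
  using assms by (simp_all add: tshear_comp profile_minus tshear_0)

lemma smooth_omega [smooth_intros]: "smooth f \<Longrightarrow> smooth (\<lambda>x. omega e (f x))"
  by (rule smooth_bounded_linear[OF omega.bounded_linear_right])

lemma smooth_shear: "smooth f \<Longrightarrow> smooth (shear e f)"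
  unfolding shear_def by (intro smooth_intros smooth_compose[of f "omega e"])

section \<open>Symplectic lifts and the group generated by shears\<close>

definition symplectic :: "('n::finite phase_space \<Rightarrow> 'n phase_space) \<Rightarrow> bool" where
  "symplectic \<Phi> \<longleftrightarrow> (\<forall>z u v. omega (frechet_derivative \<Phi> (at z) u) (frechet_derivative \<Phi> (at z) v) = omega u v)"

text \<open>The derivative is a symplectic transvection, \<open>u\<close> plus a multiple of
  \<open>omega e u\<close> times \<open>e\<close>; the two mixed terms cancel by
  antisymmetry.\<close>

lemma symplectic_shear:
  assumes "smooth f" shows "symplectic (shear e f)"
  unfolding symplectic_def
proof (intro allI)
  fix z u v
  define c where "c = frechet_derivative f (at (omega e z)) 1"
  have lin: "linear (frechet_derivative f (at (omega e z)))"
    by (rule linear_frechet_derivative[OF smooth_differentiable[OF assms]])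
  have c: "frechet_derivative f (at (omega e z)) t = t * c" for t
    using linear_scale[OF lin, of t 1] by (simp add: c_def)
  have "((\<lambda>z. f (omega e z)) has_derivative (\<lambda>u. omega e u * c)) (at z)"
    using diff_chain_at[OF bounded_linear_imp_has_derivative[OF omega.bounded_linear_right]
        smooth_has_derivative[OF assms], of e z] c by (simp add: o_def)
  then have "(shear e f has_derivative (\<lambda>u. u + (omega e u * c) *\<^sub>R e)) (at z)"
    unfolding shear_def by (auto intro!: derivative_eq_intros)
  then have "frechet_derivative (shear e f) (at z) = (\<lambda>u. u + (omega e u * c) *\<^sub>R e)"
    by (rule frechet_derivative_at[symmetric])
  then show "omega (frechet_derivative (shear e f) (at z) u) (frechet_derivative (shear e f) (at z) v) = omega u v"
    by (simp add: omega.add_right omega.add_left omega.scaleR_right omega.scaleR_left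
        omega_commute[of u e])
qed

lemma symplectic_compose:
  assumes "smooth \<Phi>" "smooth \<Psi>" "symplectic \<Phi>" "symplectic \<Psi>"
  shows "symplectic (\<lambda>z. \<Phi> (\<Psi> z))"
proof -
  have "frechet_derivative (\<lambda>z. \<Phi> (\<Psi> z)) (at z) =
      frechet_derivative \<Phi> (at (\<Psi> z)) \<circ> frechet_derivative \<Psi> (at z)" for z
    using frechet_derivative_compose[OF smooth_differentiable[OF assms(2)] smooth_differentiable[OF assms(1)]]
    by (simp add: o_def)
  with assms(3,4) show ?thesis by (simp add: symplectic_def)
qed

definition good_lift :: "('n::finite phase_space \<Rightarrow> 'n phase_space) \<Rightarrow> ('n torus \<Rightarrow> 'n torus) \<Rightarrow> bool" where
  "good_lift \<Phi> \<phi> \<longleftrightarrow> smooth_lift \<Phi> \<phi> \<and> equivariant \<Phi> \<and> symplectic \<Phi>"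

lemma good_lift_compose:
  assumes "good_lift \<Phi> \<phi>" "good_lift \<Psi> \<psi>"
  shows "good_lift (\<lambda>z. \<Phi> (\<Psi> z)) (\<phi> \<circ> \<psi>)"
  using assms by (simp add: good_lift_def smooth_lift_def smooth_compose symplectic_compose equivariant_def)

lemma good_lift_id: "good_lift (\<lambda>z. z) id"
  by (simp add: good_lift_def smooth_lift_def smooth_ident equivariant_def symplectic_def)

lemma good_lift_tshear: "e \<in> lattice \<Longrightarrow> profile f \<Longrightarrow> good_lift (shear e f) (tshear e f)"
  unfolding good_lift_def smooth_lift_def
  by (simp add: shear_equivariant symplectic_shear tshear_proj smooth_shear profile_def[THEN iffD1])

text \<open>All metric estimates take place inside this subgroup of \<open>Symp0\<close>. Adding one
  factor at a time on the right matches the deformation of the last factor in the proof that it lies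
  in the identity component.\<close>

inductive_set shear_group :: "('n::finite torus \<Rightarrow> 'n torus) set" where
  id: "id \<in> shear_group"
| step: "w \<in> shear_group \<Longrightarrow> e \<in> lattice \<Longrightarrow> profile f \<Longrightarrow> w \<circ> tshear e f \<in> shear_group"

lemma shear_group_tshear: "e \<in> lattice \<Longrightarrow> profile f \<Longrightarrow> tshear e f \<in> shear_group"
  using shear_group.step[OF shear_group.id] by fastforce

lemma shear_group_comp:
  assumes "v \<in> shear_group" "w \<in> shear_group" shows "v \<circ> w \<in> shear_group"
  using assms(2)
proof induction
  case (step w e f)
  then show ?case using shear_group.step[of "v \<circ> w" e f] by (simp only: comp_assoc)
qed (simp add: assms(1))

lemma shear_group_inverse:
  assumes "w \<in> shear_group"
  obtains v where "v \<in> shear_group" "v \<circ> w = id" "w \<circ> v = id"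
proof -
  from assms have "\<exists>v\<in>shear_group. v \<circ> w = id \<and> w \<circ> v = id"
  proof induction
    case id
    then show ?case using shear_group.id by (intro bexI[of _ id]) auto
  next
    case (step w e f)
    then obtain v where v: "v \<in> shear_group" "v \<circ> w = id" "w \<circ> v = id" by blast
    let ?s = "tshear e f" and ?t = "tshear e (\<lambda>t. - f t)"
    have st: "?s \<circ> ?t = id" "?t \<circ> ?s = id" using tshear_inverse step by blast+
    have "(?t \<circ> v) \<circ> (w \<circ> ?s) = ?t \<circ> (v \<circ> w) \<circ> ?s" "(w \<circ> ?s) \<circ> (?t \<circ> v) = w \<circ> (?s \<circ> ?t) \<circ> v"
      by (simp_all only: comp_assoc)
    then have "(?t \<circ> v) \<circ> (w \<circ> ?s) = id" "(w \<circ> ?s) \<circ> (?t \<circ> v) = id"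
      using v st by simp_all
    moreover have "?t \<circ> v \<in> shear_group"
      using v(1) step by (intro shear_group_comp shear_group_tshear profile_minus)
    ultimately show ?case by blast
  qed
  then show ?thesis using that by blast
qed

lemma shear_group_bij: "w \<in> shear_group \<Longrightarrow> bij w"
  by (metis shear_group_inverse o_bij)

lemma shear_group_inv: "w \<in> shear_group \<Longrightarrow> inv w \<in> shear_group"
  by (metis shear_group_inverse inv_unique_comp)

lemma shear_group_lift: "w \<in> shear_group \<Longrightarrow> \<exists>\<Phi>. good_lift \<Phi> w"
  by (induction rule: shear_group.induct) (blast intro: good_lift_id good_lift_compose good_lift_tshear)+

lemma shear_group_Symp: 
  assumes "w \<in> shear_group" shows "w \<in> Symp"
proof -
  from shear_group_lift[OF assms] obtain \<Phi> where "good_lift \<Phi> w" by blast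
  moreover from shear_group_lift[OF shear_group_inv[OF assms]] obtain \<Psi> where "good_lift \<Psi> (inv w)" by blast
  ultimately show ?thesis
    using shear_group_bij[OF assms] unfolding Symp_def good_lift_def symplectic_def by blast
qed

section \<open>Isotopies and the identity component\<close>

lemma smooth_iterated_deriv: "smooth f \<Longrightarrow> smooth (iterated_deriv vs f)"
  by (induction vs arbitrary: f) (auto intro: smooth_frechet_derivative)

lemma frechet_derivative_slice:
  fixes A :: "'a::euclidean_space \<times> 'b::euclidean_space \<Rightarrow> 'c::real_normed_vector"
  assumes "smooth A"
  shows "((\<lambda>z. A (t, z)) has_derivative (\<lambda>v. frechet_derivative A (at (t, z)) (0, v))) (at z)"
proof -
  have "((\<lambda>z. (t, z)) has_derivative (\<lambda>v. (0, v))) (at z)"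
    by (auto intro!: derivative_eq_intros)
  from diff_chain_at[OF this smooth_has_derivative[OF assms]] show ?thesis
    by (simp add: o_def)
qed

lemma iterated_deriv_slice:
  fixes A :: "'a::euclidean_space \<times> 'b::euclidean_space \<Rightarrow> 'c::real_normed_vector"
  assumes "smooth A"
  shows "iterated_deriv vs (\<lambda>z. A (t, z)) z = iterated_deriv (map (Pair 0) vs) A (t, z)"
  using assms
proof (induction vs arbitrary: A)
  case (Cons v vs)
  show ?case
    using Cons.IH[OF smooth_frechet_derivative[OF Cons.prems], of "(0, v)"]
    by (simp add: frechet_derivative_at[OF frechet_derivative_slice[OF Cons.prems], symmetric])
qed simp

text \<open>The first differentiation kills the constant \<open>c\<close>, so it remains for the
  empty list alone. Consequently the difference of two equivariant lifts is periodic together with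
  all its derivatives.\<close>

lemma iterated_deriv_translate:
  assumes "smooth \<Phi>" "\<And>z. \<Phi> (z + m) = \<Phi> z + c"
  shows "iterated_deriv vs \<Phi> (z + m) = iterated_deriv vs \<Phi> z + (if vs = [] then c else 0)"
  using assms
proof (induction vs arbitrary: \<Phi> c z)
  case (Cons v vs)
  have "frechet_derivative \<Phi> (at (z + m)) v = frechet_derivative \<Phi> (at z) v" for z
  proof -
    have 1: "((\<lambda>z. z + m) has_derivative (\<lambda>v. v)) (at z)" by (auto intro!: derivative_eq_intros)
    have 2: "((\<lambda>z. \<Phi> z + c) has_derivative frechet_derivative \<Phi> (at z)) (at z)"
      using smooth_has_derivative[OF Cons.prems(1)] by (auto intro!: derivative_eq_intros)
    show ?thesis
      using frechet_derivative_at[OF diff_chain_at[OF 1 smooth_has_derivative[OF Cons.prems(1)]]]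
        frechet_derivative_at[OF 2] Cons.prems(2) by (simp add: o_def)
  qed
  then show ?case
    using Cons.IH[OF smooth_frechet_derivative[OF Cons.prems(1)], of v 0] by simp
qed simp

lemma unit_cube_subset: "(unit_cube :: 'n::finite phase_space set) \<subseteq> cbox 0 (1, 1)"
  by (auto simp: unit_cube_def cbox_Pair_eq mem_box_cart zero_prod_def less_imp_le)

text \<open>A neighbourhood tests finitely many derivatives. Each is jointly continuous in time and
  space, hence uniformly continuous on a compact set, and by periodicity of the differences it is
  enough to compare time slices over the unit cube.\<close>

lemma isotopy_continuous:
  fixes A :: "real \<times> 'n::finite phase_space \<Rightarrow> 'n phase_space"
  assumes A: "smooth A" and eq: "\<And>t. equivariant (\<lambda>z. A (t, z))"
    and \<alpha>: "\<And>t. \<alpha> t \<in> Symp" "\<And>t z. \<alpha> t (torus_proj z) = torus_proj (A (t, z))"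
  shows "continuous_map euclideanreal Symp_topology \<alpha>"
  unfolding continuous_map_def
proof (intro conjI allI impI)
  show "\<alpha> \<in> topspace euclideanreal \<rightarrow> topspace Symp_topology"
    using \<alpha>(1) by (simp add: topspace_Symp_topology)
  fix U :: "('n torus \<Rightarrow> 'n torus) set" assume "openin Symp_topology U"
  then have U: "Symp_open U" by (simp add: openin_Symp_topology)
  have "\<exists>d>0. \<forall>t. dist t t0 < d \<longrightarrow> \<alpha> t \<in> U" if t0: "\<alpha> t0 \<in> U" for t0
  proof -
    from U t0 obtain k \<epsilon> where "\<epsilon> > 0" and k: "\<And>\<psi>. \<psi> \<in> Symp \<Longrightarrow> Ck_close k \<epsilon> (\<alpha> t0) \<psi> \<Longrightarrow> \<psi> \<in> U"
      unfolding Symp_open_def by blast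
    \<comment> \<open>The time interval has radius 1, so the bound \<open>min d 1\<close> below
      keeps both time slices inside \<open>K\<close>.\<close>
    define K where "K = cbox (t0 - 1) (t0 + 1) \<times> (cbox 0 (1, 1) :: 'n phase_space set)"
    have K: "compact K" unfolding K_def by (intro compact_Times compact_cbox)
    define Vs where "Vs = {vs :: 'n phase_space list. set vs \<subseteq> Basis \<and> length vs \<le> k}"
    have "finite Vs" unfolding Vs_def by (rule finite_lists_length_le) simp
    have sl: "smooth (\<lambda>z. A (t, z))" for t
      using smooth_compose[OF A, of "\<lambda>z. (t, z)"] by (simp add: smooth_Pair smooth_const smooth_ident)
    have "\<exists>d>0. \<forall>t z. dist t t0 < d \<longrightarrow>
       norm (iterated_deriv vs (\<lambda>z. A (t0, z)) z - iterated_deriv vs (\<lambda>z. A (t, z)) z) < \<epsilon>" for vs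
    proof -
      let ?g = "iterated_deriv (map (Pair 0) vs) A"
      have "uniformly_continuous_on K ?g"
        by (intro compact_uniformly_continuous K continuous_on_subset[OF smooth_continuous]
            smooth_iterated_deriv A) auto
      then obtain d where d: "d > 0" "\<And>p q. p \<in> K \<Longrightarrow> q \<in> K \<Longrightarrow> dist q p < d \<Longrightarrow> dist (?g q) (?g p) < \<epsilon>"
        unfolding uniformly_continuous_on_def using \<open>\<epsilon> > 0\<close> by metis
      have "norm (iterated_deriv vs (\<lambda>z. A (t0, z)) z - iterated_deriv vs (\<lambda>z. A (t, z)) z) < \<epsilon>"
        if t: "dist t t0 < min d 1" for t z
      proof -
        obtain m where m: "m \<in> lattice" "z + m \<in> unit_cube" by (rule lattice_reduce)
        have tr: "iterated_deriv vs (\<lambda>z. A (s, z)) (z + m) =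
            iterated_deriv vs (\<lambda>z. A (s, z)) z + (if vs = [] then m else 0)" for s
          using eq m by (intro iterated_deriv_translate sl) (simp add: equivariant_def)
        have "(t0, z + m) \<in> K" "(t, z + m) \<in> K"
          using m unit_cube_subset t by (auto simp: K_def dist_real_def)
        moreover have "dist (t0, z + m) (t, z + m) < d"
          using t by (simp add: dist_Pair_Pair dist_commute)
        ultimately have "dist (?g (t0, z + m)) (?g (t, z + m)) < \<epsilon>" by (intro d(2))
        then show ?thesis
          unfolding iterated_deriv_slice[OF A, symmetric] tr by (simp add: dist_norm)
      qed
      then show ?thesis using d(1) by (intro exI[of _ "min d 1"]) auto
    qed
    then obtain d where d: "\<And>vs. d vs > 0" "\<And>vs t z. dist t t0 < d vs \<Longrightarrow>
       norm (iterated_deriv vs (\<lambda>z. A (t0, z)) z - iterated_deriv vs (\<lambda>z. A (t, z)) z) < \<epsilon>"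
      by metis
    define \<delta> where "\<delta> = Min (d ` Vs)"
    have "Vs \<noteq> {}" unfolding Vs_def by (intro ex_in_conv[THEN iffD1] exI[of _ "[]"]) simp
    then have "\<delta> > 0" using \<open>finite Vs\<close> d(1) by (simp add: \<delta>_def)
    moreover have "\<alpha> t \<in> U" if "dist t t0 < \<delta>" for t
    proof (rule k[OF \<alpha>(1)])
      have "norm (iterated_deriv vs (\<lambda>z. A (t0, z)) z - iterated_deriv vs (\<lambda>z. A (t, z)) z) < \<epsilon>"
        if "vs \<in> Vs" for vs z
      proof (rule d(2))
        have "\<delta> \<le> d vs" unfolding \<delta>_def using \<open>finite Vs\<close> that by (intro Min_le) auto
        then show "dist t t0 < d vs" using \<open>dist t t0 < \<delta>\<close> by simp
      qed
      then show "Ck_close k \<epsilon> (\<alpha> t0) (\<alpha> t)"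
        unfolding Ck_close_def using sl \<alpha>(2)
        by (intro exI[of _ "\<lambda>z. A (t0, z)"] exI[of _ "\<lambda>z. A (t, z)"]) (auto simp: smooth_lift_def Vs_def)
    qed
    ultimately show ?thesis by blast
  qed
  then show "openin euclideanreal {x \<in> topspace euclideanreal. \<alpha> x \<in> U}"
    by (auto simp: open_dist)
qed

text \<open>Multiplying the profile of the last factor by \<open>t\<close> connects \<open>w\<close>
  to its product with the shear; induction on the number of factors reaches the identity.\<close>

lemma shear_group_Symp0: "w \<in> shear_group \<Longrightarrow> w \<in> Symp0"
proof (induction rule: shear_group.induct)
  case id
  show ?case
    using shear_group_Symp[OF shear_group.id]
    by (simp only: Symp0_def connected_component_of_refl topspace_Symp_topology mem_Collect_eq)
next
  case (step w e f)
  obtain \<Phi> where \<Phi>: "good_lift \<Phi> w" using shear_group_lift[OF step(1)] by blast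
  define \<alpha> where "\<alpha> t = w \<circ> tshear e (\<lambda>s. t * f s)" for t
  define A where "A = (\<lambda>(t, z). \<Phi> (shear e (\<lambda>s. t * f s) z))"
  have "continuous_map euclideanreal Symp_topology \<alpha>"
  proof (rule isotopy_continuous)
    have "smooth f" using step by (simp add: profile_def)
    then have "smooth (\<lambda>p :: real \<times> 'a phase_space. snd p + (fst p * f (omega e (snd p))) *\<^sub>R e)"
      by (intro smooth_intros smooth_compose[of f "\<lambda>p. omega e (snd p)"])
    then show "smooth A" 
      using \<Phi> smooth_compose[of \<Phi> "\<lambda>p. snd p + (fst p * f (omega e (snd p))) *\<^sub>R e"]
      unfolding A_def good_lift_def smooth_lift_def shear_def case_prod_beta by auto
    have lift: "good_lift (\<lambda>z. A (t, z)) (\<alpha> t)" for t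
      using good_lift_compose[OF \<Phi> good_lift_tshear[OF step(2) profile_scale[OF step(3)]]]
      by (simp add: A_def \<alpha>_def)
    then show "equivariant (\<lambda>z. A (t, z))" "\<alpha> t (torus_proj z) = torus_proj (A (t, z))" for t z
      by (auto simp: good_lift_def smooth_lift_def)
    show "\<alpha> t \<in> Symp" for t
      unfolding \<alpha>_def by (intro shear_group_Symp shear_group.step step profile_scale)
  qed
  then have "connectedin Symp_topology (\<alpha> ` UNIV)"
    by (rule connectedin_continuous_map_image) (simp add: connectedin_iff_connected)
  then have "connected_component_of Symp_topology (\<alpha> 0) (\<alpha> 1)"
    unfolding connected_component_of_def by blast
  moreover have "\<alpha> 0 = w" "\<alpha> 1 = w \<circ> tshear e f" by (simp_all add: \<alpha>_def tshear_0)
  ultimately show ?case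
    using step(4) unfolding Symp0_def by (metis connected_component_of_trans mem_Collect_eq)
qed

section \<open>The covering \<open>z \<mapsto> k z\<close> and the volume\<close>

lemma emeasure_lborel_affine:
  fixes S :: "'a::euclidean_space set"
  assumes "c \<noteq> 0" "S \<in> sets borel"
  shows "ennreal (\<bar>c\<bar> ^ DIM('a)) * emeasure lborel {x. t + c *\<^sub>R x \<in> S} = emeasure lborel S"
proof -
  have "emeasure lborel S = emeasure (density (distr lborel borel (\<lambda>x. t + c *\<^sub>R x)) (\<lambda>_. \<bar>c\<bar> ^ DIM('a))) S"
    using lborel_affine[OF assms(1), of t] by simp
  also have "\<dots> = ennreal (\<bar>c\<bar> ^ DIM('a)) * emeasure (distr lborel borel (\<lambda>x. t + c *\<^sub>R x)) S"
    using assms(2) by (subst emeasure_density_const) simp_all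
  also have "emeasure (distr lborel borel (\<lambda>x. t + c *\<^sub>R x)) S = emeasure lborel {x. t + c *\<^sub>R x \<in> S}"
    using assms(2) by (subst emeasure_distr) (simp_all add: vimage_def)
  finally show ?thesis by simp
qed

text \<open>The dilation by \<open>k\<close> maps each of the \<open>k ^ DIM('a)\<close> congruent
  subcubes onto an integral translate of \<open>C\<close>, and \<open>U\<close> looks the same in
  all translates. The number of subcubes cancels the scaling factor of the volume.\<close>

lemma emeasure_cube_multiple:
  fixes U :: "'a::euclidean_space set"
  defines "C \<equiv> {z::'a. \<forall>b\<in>Basis. 0 \<le> z \<bullet> b \<and> z \<bullet> b < 1}"
  assumes U: "U \<in> sets borel" "\<And>z m. (\<And>b. b \<in> Basis \<Longrightarrow> m \<bullet> b \<in> \<int>) \<Longrightarrow> z + m \<in> U \<longleftrightarrow> z \<in> U"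
    and k: "k > 0"
  shows "emeasure lborel {z \<in> C. real k *\<^sub>R z \<in> U} = emeasure lborel (C \<inter> U)"
proof -
  define I :: "('a \<Rightarrow> nat) set" where "I = Basis \<rightarrow>\<^sub>E {..<k}"
  define t where "t a = (\<Sum>b\<in>Basis. real (a b) *\<^sub>R b)" for a :: "'a \<Rightarrow> nat"
  \<comment> \<open>This is the part of the set in the subcube with corner \<open>t a\<close>
    divided by \<open>k\<close>; the digits \<open>a\<close> are recovered as integer parts of the
    scaled coordinates.\<close>
  define P where "P a = {z. - t a + real k *\<^sub>R z \<in> C \<inter> U}" for a
  have t: "t a \<bullet> b = real (a b)" if "b \<in> Basis" for a b
    using that by (simp add: t_def inner_sum_left_Basis)
  have "C = (\<Inter>b\<in>Basis. {z. 0 \<le> z \<bullet> b \<and> z \<bullet> b < 1})" by (auto simp: C_def)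
  moreover have "{z::'a. 0 \<le> z \<bullet> b \<and> z \<bullet> b < 1} \<in> sets borel" for b by measurable
  ultimately have C: "C \<in> sets borel" by (auto intro!: sets.finite_INT)
  have P_iff: "z \<in> P a \<longleftrightarrow> (\<forall>b\<in>Basis. real (a b) \<le> real k * (z \<bullet> b) \<and> real k * (z \<bullet> b) < real (a b) + 1) \<and> real k *\<^sub>R z \<in> U"
    for z a
  proof -
    have "- t a + real k *\<^sub>R z \<in> U \<longleftrightarrow> real k *\<^sub>R z \<in> U"
      using U(2)[of "- t a" "real k *\<^sub>R z"] t by (simp add: add.commute)
    then show ?thesis by (auto simp: P_def C_def t inner_diff_left)
  qed
  have floor: "a b = nat \<lfloor>real k * (z \<bullet> b)\<rfloor>" if "z \<in> P a" "b \<in> Basis" for z a b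
  proof -
    have "\<lfloor>real k * (z \<bullet> b)\<rfloor> = int (a b)"
      using that unfolding P_iff by (intro floor_unique) auto
    then show ?thesis by simp
  qed
  have scale: "ennreal (real k ^ DIM('a)) * emeasure lborel (P a) = emeasure lborel (C \<inter> U)" for a
  proof -
    have "real k \<noteq> 0" "C \<inter> U \<in> sets borel" using k C U(1) by auto
    from emeasure_lborel_affine[OF this, of "- t a"] show ?thesis
      by (simp only: P_def abs_of_nat)
  qed
  have disj: "disjoint_family_on P I"
    unfolding disjoint_family_on_def
  proof (intro ballI impI)
    fix a a' assume "a \<in> I" "a' \<in> I" "a \<noteq> a'"
    then obtain b where "b \<in> Basis" "a b \<noteq> a' b"
      unfolding I_def by (metis PiE_ext)
    then show "P a \<inter> P a' = {}" using floor[of _ a b] floor[of _ a' b] by auto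
  qed
  have "{z \<in> C. real k *\<^sub>R z \<in> U} = (\<Union>a\<in>I. P a)"
  proof (intro equalityI subsetI)
    fix z assume z: "z \<in> {z \<in> C. real k *\<^sub>R z \<in> U}"
    let ?a = "restrict (\<lambda>b. nat \<lfloor>real k * (z \<bullet> b)\<rfloor>) Basis"
    have b: "0 \<le> real k * (z \<bullet> b)" "real k * (z \<bullet> b) < real k" if "b \<in> Basis" for b
      using z that k by (auto simp: C_def)
    then have "?a \<in> I" by (auto simp: I_def nat_less_iff floor_less_iff)
    moreover have "z \<in> P ?a"
      using z b by (auto simp: P_iff of_nat_nat)
    ultimately show "z \<in> (\<Union>a\<in>I. P a)" by blast
  next
    fix z assume "z \<in> (\<Union>a\<in>I. P a)"
    then obtain a where a: "a \<in> I" "z \<in> P a" by blast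
    have "0 \<le> z \<bullet> b \<and> z \<bullet> b < 1" if "b \<in> Basis" for b
    proof -
      have "0 \<le> real k * (z \<bullet> b)" "real k * (z \<bullet> b) < real (a b) + 1"
        using a(2) that unfolding P_iff by (auto intro: order_trans[OF of_nat_0_le_iff])
      moreover have "real (a b) + 1 \<le> real k" using a(1) that by (auto simp: I_def PiE_iff Suc_le_eq)
      ultimately have "0 \<le> real k * (z \<bullet> b)" "real k * (z \<bullet> b) < real k * 1" by linarith+
      then show ?thesis using k by (simp only: zero_le_mult_iff mult_less_cancel_left_pos of_nat_0_less_iff) auto
    qed
    then show "z \<in> {z \<in> C. real k *\<^sub>R z \<in> U}" using a(2) by (auto simp: C_def P_iff)
  qed
  moreover have "P a \<in> sets lborel" for a
    using C U(1) unfolding P_def by measurable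
  then have "emeasure lborel (\<Union>a\<in>I. P a) = (\<Sum>a\<in>I. emeasure lborel (P a))"
    by (intro sum_emeasure[symmetric] disj) (auto simp: I_def finite_PiE)
  ultimately have "emeasure lborel {z \<in> C. real k *\<^sub>R z \<in> U} = (\<Sum>a\<in>I. emeasure lborel (P a))"
    by simp
  also have "\<dots> = of_nat (card I) * emeasure lborel (P (\<lambda>_. 0))"
  proof -
    have "emeasure lborel (P a) = emeasure lborel (P a')" for a a'
    proof -
      have "ennreal (real k ^ DIM('a)) * emeasure lborel (P a) = ennreal (real k ^ DIM('a)) * emeasure lborel (P a')"
        by (simp only: scale)
      moreover have "real k ^ DIM('a) > 0" using k by simp
      ultimately show ?thesis by (simp add: ennreal_mult_cancel_left ennreal_eq_0_iff)
    qed
    then show ?thesis by (metis (no_types, lifting) sum.cong sum_constant)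
  qed
  also have "of_nat (card I) = ennreal (real k ^ DIM('a))"
    by (simp add: I_def card_PiE ennreal_of_nat_eq_real_of_nat)
  also have "ennreal (real k ^ DIM('a)) * emeasure lborel (P (\<lambda>_. 0)) = emeasure lborel (C \<inter> U)"
    by (rule scale)
  finally show ?thesis .
qed

section \<open>The volume measure of the torus\<close>

lemma phase_space_Basis_iff:
  "(\<forall>b\<in>Basis. P (z \<bullet> b)) \<longleftrightarrow> (\<forall>i. P (fst z $ i) \<and> P (snd z $ i))" for z :: "'n::finite phase_space"
  by (auto simp: Basis_prod_def Basis_vec_def inner_axis inner_prod_def ball_Un)

lemma continuous_torus_proj: "continuous_on UNIV (torus_proj :: 'n::finite phase_space \<Rightarrow> _)"
  by (simp add: continuous_on_open_vimage open_torus_def)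

lemma continuous_torusI:
  assumes "continuous_on UNIV (\<lambda>z. f (torus_proj z))" shows "continuous_on UNIV f"
  using assms by (simp add: continuous_on_open_vimage open_torus_def vimage_def)

lemma measurable_torus_proj [measurable]: "torus_proj \<in> borel_measurable borel"
  by (rule borel_measurable_continuous_onI[OF continuous_torus_proj])

lemma unit_cube_eq: "unit_cube = {z::'n::finite phase_space. \<forall>b\<in>Basis. 0 \<le> z \<bullet> b \<and> z \<bullet> b < 1}"
  using phase_space_Basis_iff[of "\<lambda>t. 0 \<le> t \<and> t < 1"] by (auto simp: unit_cube_def)

lemma unit_cube_borel: "unit_cube \<in> sets (borel :: 'n::finite phase_space measure)"
proof -
  have "unit_cube = (\<Inter>b\<in>Basis. {z :: 'n phase_space. 0 \<le> z \<bullet> b \<and> z \<bullet> b < 1})"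
    unfolding unit_cube_eq by blast
  moreover have "{z :: 'n phase_space. 0 \<le> z \<bullet> b \<and> z \<bullet> b < 1} \<in> sets borel" for b by measurable
  ultimately show ?thesis by (metis (no_types, lifting) sets.finite_INT finite_Basis nonempty_Basis)
qed

lemma sets_torus_vol [simp, measurable_cong]: "sets torus_vol = sets borel"
  and space_torus_vol [simp]: "space torus_vol = UNIV"
  by (simp_all add: torus_vol_def)

lemma emeasure_torus_vol:
  fixes X :: "'n::finite torus set"
  assumes "X \<in> sets borel"
  shows "emeasure torus_vol X = fact CARD('n) * emeasure lborel (unit_cube \<inter> torus_proj -` X)"
proof -
  have "emeasure torus_vol X = emeasure (scale_measure (fact CARD('n)) (restrict_space lborel unit_cube))
      (torus_proj -` X \<inter> unit_cube)"
    unfolding torus_vol_def using assms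
    by (subst emeasure_distr)
      (simp_all add: space_scale_measure space_restrict_space measurable_restrict_space1
        cong: measurable_cong_sets[OF sets_scale_measure refl])
  also have "\<dots> = fact CARD('n) * emeasure lborel (unit_cube \<inter> torus_proj -` X)"
    using unit_cube_borel by (simp add: Int_commute[of _ unit_cube]) (subst emeasure_restrict_space; simp)
  finally show ?thesis .
qed

lemma torus_vol_UNIV:
  "0 < emeasure (torus_vol :: 'n::finite torus measure) UNIV"
  "emeasure (torus_vol :: 'n::finite torus measure) UNIV < \<infinity>"
proof -
  let ?C = "unit_cube :: 'n phase_space set"
  have "emeasure lborel (box 0 (\<Sum>Basis) :: 'n phase_space set) \<le> emeasure lborel ?C"
    proof (intro emeasure_mono subsetI)
    fix x :: "'n phase_space" assume x: "x \<in> box 0 (\<Sum>Basis)"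
    have "(\<Sum>Basis) \<bullet> b = (1::real)" if "b \<in> Basis" for b :: "'n phase_space"
      using that by (simp add: inner_sum_left inner_Basis)
    then show "x \<in> ?C" using x by (simp add: unit_cube_eq mem_box less_imp_le)
  qed (simp add: unit_cube_borel)
  then have "0 < emeasure lborel ?C"
    by (simp add: emeasure_lborel_box_eq) (metis less_le_trans zero_less_one)
  moreover have "emeasure lborel ?C \<le> emeasure lborel (cbox 0 (1, 1) :: 'n phase_space set)"
    by (intro emeasure_mono unit_cube_subset) auto
  then have "emeasure lborel ?C < \<infinity>"
    using emeasure_lborel_cbox_finite by (rule le_less_trans)
  moreover have "(fact CARD('n) :: ennreal) = of_nat (fact CARD('n))" by simp
  then have "0 < (fact CARD('n) :: ennreal)" "(fact CARD('n) :: ennreal) < top"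
    by (simp_all only: of_nat_less_top of_nat_0_less_iff fact_gt_zero)
  ultimately show "0 < emeasure (torus_vol :: 'n torus measure) UNIV"
      "emeasure (torus_vol :: 'n torus measure) UNIV < \<infinity>"
    by (simp_all add: emeasure_torus_vol ennreal_zero_less_mult_iff ennreal_mult_less_top)
qed

lemma finite_measure_torus_vol: "finite_measure (torus_vol :: 'n::finite torus measure)"
  using torus_vol_UNIV(2) by (intro finite_measureI) (simp add: less_top[symmetric])

definition torus_mult :: "nat \<Rightarrow> 'n::finite torus \<Rightarrow> 'n torus" where
  "torus_mult k = torus_map (\<lambda>z. real k *\<^sub>R z)"

lemma torus_mult_proj: "torus_mult k (torus_proj z) = torus_proj (real k *\<^sub>R z)"
  unfolding torus_mult_def
  by (rule torus_map_proj) (simp add: lattice_scale flip: scaleR_diff_right)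

lemma continuous_torus_mult: "continuous_on UNIV (torus_mult k :: 'n::finite torus \<Rightarrow> _)"
proof (rule continuous_torusI)
  have "continuous_on UNIV (\<lambda>z :: 'n phase_space. torus_proj (real k *\<^sub>R z))"
    by (rule continuous_on_compose2[OF continuous_torus_proj]) (auto intro!: continuous_intros)
  then show "continuous_on UNIV (\<lambda>z :: 'n phase_space. torus_mult k (torus_proj z))"
    by (simp add: torus_mult_proj)
qed

text \<open>On the fundamental cube this is \<open>emeasure_cube_multiple\<close> for the
  lattice-periodic preimage of \<open>X\<close>. Hence pulling a function back along the covering
  changes neither its mean nor its distribution.\<close>

lemma distr_torus_mult:
  assumes "k > 0"
  shows "distr torus_vol borel (torus_mult k) = (torus_vol :: 'n::finite torus measure)"
proof (rule measure_eqI)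
  fix X :: "'n torus set" assume "X \<in> sets (distr torus_vol borel (torus_mult k))"
  then have X: "X \<in> sets borel" by simp
  have meas: "torus_mult k \<in> borel_measurable (borel :: 'n torus measure)"
    by (rule borel_measurable_continuous_onI[OF continuous_torus_mult])
  have "torus_mult k -` X \<in> sets borel"
    using measurable_sets[OF meas X] by simp
  moreover have "unit_cube \<inter> torus_proj -` torus_mult k -` X =
      {z \<in> unit_cube. real k *\<^sub>R z \<in> torus_proj -` X}"
    by (auto simp: torus_mult_proj)
  moreover have "emeasure lborel {z \<in> unit_cube. real k *\<^sub>R z \<in> torus_proj -` X} =
      emeasure lborel (unit_cube \<inter> torus_proj -` X)"
    unfolding unit_cube_eq
  proof (rule emeasure_cube_multiple[OF _ _ assms])
    show "torus_proj -` X \<in> sets borel"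
      using measurable_sets[OF measurable_torus_proj X] by simp
    fix z m :: "'n phase_space" assume "\<And>b. b \<in> Basis \<Longrightarrow> m \<bullet> b \<in> \<int>"
    then have "m \<in> lattice" using phase_space_Basis_iff[of "\<lambda>t. t \<in> \<int>" m] by (auto simp: lattice_iff)
    then show "z + m \<in> torus_proj -` X \<longleftrightarrow> z \<in> torus_proj -` X" by (simp add: torus_proj_add)
  qed
  ultimately show "emeasure (distr torus_vol borel (torus_mult k)) X = emeasure torus_vol X"
    using X meas by (simp add: emeasure_distr emeasure_torus_vol)
qed simp

lemma normalized_measurable:
  assumes "F \<in> normalized_functions" shows "F \<in> borel_measurable borel"
  using assms unfolding normalized_functions_def
  by (auto intro!: borel_measurable_continuous_onI continuous_torusI smooth_continuous)

lemma normalized_torus_mult: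
  fixes F :: "'n::finite torus \<Rightarrow> real"
  assumes "F \<in> normalized_functions" "k > 0"
  shows "(\<lambda>p. F (torus_mult k p)) \<in> normalized_functions"
    and "chi (\<lambda>p. F (torus_mult k p)) = chi F"
proof -
  have meas: "torus_mult k \<in> borel_measurable (borel :: 'n torus measure)"
    by (rule borel_measurable_continuous_onI[OF continuous_torus_mult])
  have "integral\<^sup>L torus_vol (\<lambda>p. F (torus_mult k p)) = integral\<^sup>L (distr torus_vol borel (torus_mult k)) F"
    using meas normalized_measurable[OF assms(1)] by (intro integral_distr[symmetric]) simp_all
  moreover have "smooth (\<lambda>z. F (torus_mult k (torus_proj z)))"
    using assms(1) smooth_compose[of "\<lambda>z. F (torus_proj z)" "\<lambda>z. real k *\<^sub>R z"]
    by (simp add: torus_mult_proj normalized_functions_def smooth_scaleR smooth_const smooth_ident)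
  ultimately show "(\<lambda>p. F (torus_mult k p)) \<in> normalized_functions"
    using assms by (simp add: normalized_functions_def distr_torus_mult)
  have "measure torus_vol {p. F (torus_mult k p) < c} = measure torus_vol {p. F p < c}" for c
  proof -
    have "{p. F p < c} \<in> sets borel"
      using measurable_sets[OF normalized_measurable[OF assms(1)], of "{..<c}"] by (simp add: vimage_def)
    then have "measure (distr torus_vol borel (torus_mult k)) {p. F p < c} = measure torus_vol {p. F (torus_mult k p) < c}"
      using meas by (subst measure_distr) (simp_all add: vimage_def)
    then show ?thesis by (simp add: distr_torus_mult assms)
  qed
  then show "chi (\<lambda>p. F (torus_mult k p)) = chi F"
    by (simp add: chi_def fun_eq_iff)
qed

lemma normalized_cmult: "F \<in> normalized_functions \<Longrightarrow> (\<lambda>p. c * F p) \<in> normalized_functions"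
  by (simp add: normalized_functions_def smooth_mult smooth_const)

text \<open>Every point has a representative in a compact cube, so \<open>F\<close> is bounded and
  integrable for the finite volume; \<open>c\<close> is its mean value.\<close>

lemma normalize:
  fixes F :: "'n::finite torus \<Rightarrow> real"
  assumes "smooth (\<lambda>z. F (torus_proj z))"
  obtains c where "(\<lambda>p. F p - c) \<in> normalized_functions"
proof -
  interpret finite_measure "torus_vol :: 'n torus measure" by (rule finite_measure_torus_vol)
  have cont: "continuous_on UNIV (\<lambda>z. F (torus_proj z))" by (rule smooth_continuous[OF assms])
  have "compact ((\<lambda>z. F (torus_proj z)) ` cbox 0 (1, 1))"
    by (intro compact_continuous_image continuous_on_subset[OF cont]) auto
  then obtain B where B: "\<And>z. z \<in> cbox 0 (1, 1) \<Longrightarrow> norm (F (torus_proj z)) \<le> B"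
    by (meson compact_imp_bounded bounded_iff imageI)
  have "norm (F p) \<le> B" for p
  proof -
    obtain m where m: "m \<in> lattice" "torus_rep p + m \<in> unit_cube" by (rule lattice_reduce)
    then show ?thesis
      using B[of "torus_rep p + m"] unit_cube_subset by (auto simp: torus_proj_add torus_proj_rep)
  qed
  moreover have "F \<in> borel_measurable torus_vol"
    using borel_measurable_continuous_onI[OF continuous_torusI[OF cont]] by (simp cong: measurable_cong_sets)
  ultimately have F: "integrable torus_vol F"
    by (intro integrable_const_bound[of _ B]) auto
  let ?c = "integral\<^sup>L torus_vol F / measure (torus_vol :: 'n torus measure) UNIV"
  have "measure (torus_vol :: 'n torus measure) UNIV \<noteq> 0"
    using torus_vol_UNIV(1)[where 'n = 'n] by (simp add: emeasure_eq_measure)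
  then have "integral\<^sup>L torus_vol (\<lambda>p. F p - ?c) = 0"
    using F by simp
  then have "(\<lambda>p. F p - ?c) \<in> normalized_functions"
    using assms by (simp add: normalized_functions_def smooth_diff smooth_const)
  then show ?thesis by (rule that)
qed

text \<open>Each coordinate is continuous and integer-valued, and distinct integers are at distance
  at least 1. This is how two lifts of the same map are compared.\<close>

lemma lattice_valued_constant:
  fixes f :: "'a::topological_space \<Rightarrow> 'n::finite phase_space"
  assumes "connected S" "continuous_on S f" "\<And>x. x \<in> S \<Longrightarrow> f x \<in> lattice" "x \<in> S" "y \<in> S"
  shows "f x = f y"
proof (rule euclidean_eqI)
  fix b :: "'n phase_space" assume b: "b \<in> Basis"
  have Ints: "f x \<bullet> b \<in> \<int>" if "x \<in> S" for x
    using assms(3)[OF that] phase_space_Basis_iff[of "\<lambda>t. t \<in> \<int>" "f x"] b by (auto simp: lattice_iff)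
  have "(\<lambda>x. f x \<bullet> b) constant_on S"
  proof (rule continuous_discrete_range_constant[OF assms(1)])
    show "continuous_on S (\<lambda>x. f x \<bullet> b)" using assms(2) by (intro continuous_intros)
    show "\<exists>e>0. \<forall>y. y \<in> S \<and> f y \<bullet> b \<noteq> f x \<bullet> b \<longrightarrow> e \<le> norm (f y \<bullet> b - f x \<bullet> b)" if "x \<in> S" for x
      using Ints that by (intro exI[of _ 1]) (auto intro!: Ints_nonzero_abs_ge1)
  qed
  then show "f x \<bullet> b = f y \<bullet> b" using assms(4,5) by (auto simp: constant_on_def)
qed

section \<open>Hamiltonian paths\<close>

definition ham_lift ::
  "(real \<Rightarrow> 'n::finite torus \<Rightarrow> real) \<Rightarrow> (real \<Rightarrow> 'n torus \<Rightarrow> 'n torus) \<Rightarrow> (real \<times> 'n phase_space \<Rightarrow> 'n phase_space) \<Rightarrow> bool"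
where
  "ham_lift F \<alpha> A \<longleftrightarrow> smooth A \<and> (\<forall>t\<in>{0..1}. \<forall>z. \<alpha> t (torus_proj z) = torus_proj (A (t, z)) \<and>
     is_ham_vector (F t) (A (t, z)) (vector_derivative (\<lambda>s. A (s, z)) (at t)))"

lemma generates_iff:
  "generates F \<alpha> \<longleftrightarrow> smooth (\<lambda>(t, z). F t (torus_proj z)) \<and> (\<exists>A. ham_lift F \<alpha> A)"
  by (simp add: generates_def ham_lift_def)

lemma smooth_time_slice:
  fixes A :: "real \<times> 'a::euclidean_space \<Rightarrow> 'c::real_normed_vector"
  assumes "smooth A"
  shows "((\<lambda>s. A (s, z)) has_vector_derivative frechet_derivative A (at (t, z)) (1, 0)) (at t)"
proof -
  have lin: "linear (frechet_derivative A (at (t, z)))"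
    by (rule linear_frechet_derivative[OF smooth_differentiable[OF assms]])
  have "((\<lambda>s. (s, z)) has_derivative (\<lambda>h. (h, 0))) (at t)"
    by (auto intro!: derivative_eq_intros)
  from diff_chain_at[OF this smooth_has_derivative[OF assms]]
  have "((\<lambda>s. A (s, z)) has_derivative (\<lambda>h. frechet_derivative A (at (t, z)) (h *\<^sub>R (1, 0)))) (at t)"
    by (simp add: o_def)
  then show ?thesis
    by (simp only: linear_scale[OF lin] has_vector_derivative_def)
qed

lemma smooth_slice:
  assumes "smooth A" shows "smooth (\<lambda>z. A (t, z))"
  using smooth_compose[OF assms, of "\<lambda>z. (t, z)"] by (simp add: smooth_Pair smooth_const smooth_ident)

text \<open>Running the path at speed \<open>t\<close> makes its point at time \<open>t\<close> the
  endpoint of a path over the unit interval; the Hamiltonian is multiplied by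
  \<open>t\<close>.\<close>

lemma Ham_pathI:
  fixes F :: "real \<Rightarrow> 'n::finite torus \<Rightarrow> real"
  assumes "generates F \<alpha>" "\<alpha> 0 = id" "t \<in> {0..1}"
  shows "\<alpha> t \<in> Ham"
proof -
  obtain A where A: "ham_lift F \<alpha> A" and F: "smooth (\<lambda>(t, z). F t (torus_proj z))"
    using assms(1) by (auto simp: generates_iff)
  have sA: "smooth A" using A by (simp add: ham_lift_def)
  let ?r = "\<lambda>p :: real \<times> 'n phase_space. (t * fst p, snd p)"
  have r: "smooth ?r" by (intro smooth_intros)
  have "smooth (\<lambda>p. t * (\<lambda>(t, z). F t (torus_proj z)) (?r p))"
    by (intro smooth_mult smooth_const smooth_compose[OF F r])
  then have "smooth (\<lambda>(s, z). t * F (t * s) (torus_proj z))" by (simp only: case_prod_unfold fst_conv snd_conv)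
  moreover have "ham_lift (\<lambda>s p. t * F (t * s) p) (\<lambda>s. \<alpha> (t * s)) (\<lambda>p. A (?r p))"
    unfolding ham_lift_def
  proof (intro conjI ballI allI)
    show "smooth (\<lambda>p. A (?r p))" by (rule smooth_compose[OF sA r])
    fix s :: real and z assume s: "s \<in> {0..1}"
    with assms(3) have ts: "t * s \<in> {0..1}" by (auto intro: mult_le_one)
    show "\<alpha> (t * s) (torus_proj z) = torus_proj (A (t * fst (s, z), snd (s, z)))"
      using A ts by (simp add: ham_lift_def)
    have "vector_derivative (\<lambda>s. A (t * fst (s, z), snd (s, z))) (at s) = t *\<^sub>R vector_derivative (\<lambda>s. A (s, z)) (at (t * s))"
    proof -
      have "((*) t has_vector_derivative t) (at s)"
        by (auto intro!: derivative_eq_intros)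
      from vector_diff_chain_at[OF this smooth_time_slice[OF sA, of z]] show ?thesis
        unfolding vector_derivative_at[OF smooth_time_slice[OF sA]]
        by (simp add: o_def vector_derivative_at)
    qed
    moreover have "frechet_derivative (\<lambda>w. t * F (t * s) (torus_proj w)) (at y) v =
        t * frechet_derivative (\<lambda>w. F (t * s) (torus_proj w)) (at y) v" for y v
    proof -
      have "smooth (\<lambda>w. F (t * s) (torus_proj w))" using smooth_slice[OF F, of "t * s"] by simp
      from has_derivative_mult_right[OF smooth_has_derivative[OF this], of t y]
      show ?thesis by (simp add: frechet_derivative_at[symmetric])
    qed
    ultimately show "is_ham_vector (\<lambda>p. t * F (t * s) p) (A (t * fst (s, z), snd (s, z)))
        (vector_derivative (\<lambda>s. A (t * fst (s, z), snd (s, z))) (at s))"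
      using A ts by (simp add: is_ham_vector_def ham_lift_def omega.scaleR_left)
  qed
  ultimately have "generates (\<lambda>s p. t * F (t * s) p) (\<lambda>s. \<alpha> (t * s))"
    unfolding generates_iff by blast
  then show ?thesis
    unfolding Ham_def using assms(2) by (intro CollectI exI[of _ "\<lambda>s p. t * F (t * s) p"] exI[of _ "\<lambda>s. \<alpha> (t * s)"]) simp
qed

text \<open>At time 0 a lift covers the identity, hence is a translation by a lattice vector, which
  can be subtracted. Equivariance then spreads from time 0 to all of [0,1] by continuity.\<close>

lemma ham_lift_normalized:
  fixes F :: "real \<Rightarrow> 'n::finite torus \<Rightarrow> real"
  assumes "generates F \<alpha>" "\<alpha> 0 = id"
  obtains A where "ham_lift F \<alpha> A" "\<And>z. A (0, z) = z"
    "\<And>t. t \<in> {0..1} \<Longrightarrow> equivariant (\<lambda>z. A (t, z))"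
proof -
  obtain A where A: "ham_lift F \<alpha> A" and F: "smooth (\<lambda>(t, z). F t (torus_proj z))"
    using assms(1) by (auto simp: generates_iff)
  have sA: "smooth A" using A by (simp add: ham_lift_def)
  have cont: "continuous_on UNIV A" by (rule smooth_continuous[OF sA])
  have 0: "A (0, z) - z \<in> lattice" for z
  proof -
    have "\<alpha> 0 (torus_proj z) = torus_proj (A (0, z))" using A by (simp add: ham_lift_def)
    then show ?thesis using assms(2) by (simp add: torus_proj_eq_iff[symmetric])
  qed
  define c where "c = A (0, 0)"
  have A0: "A (0, z) = z + c" for z
  proof -
    have "A (0, z) - z = A (0, 0) - 0"
      by (rule lattice_valued_constant[of UNIV "\<lambda>z. A (0, z) - z"])
        (auto intro!: continuous_intros continuous_on_compose2[OF cont] 0)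
    then show ?thesis by (simp add: c_def algebra_simps)
  qed
  have c: "c \<in> lattice" using 0[of 0] by (simp add: c_def)
  have eq: "A (t, z + m) = A (t, z) + m" if "m \<in> lattice" "t \<in> {0..1}" for t z m
  proof -
    \<comment> \<open>The difference of the two trajectories is a lattice vector depending
      continuously on time, so it keeps its initial value.\<close>
    have "A (t, z + m) - A (t, z) = A (0, z + m) - A (0, z)"
    proof (rule lattice_valued_constant[of "{0..1}" "\<lambda>t. A (t, z + m) - A (t, z)"])
      show "A (t, z + m) - A (t, z) \<in> lattice" if "t \<in> {0..1}" for t
        using A that torus_proj_add[OF \<open>m \<in> lattice\<close>, of z] unfolding ham_lift_def
        by (metis torus_proj_eq_iff)
    qed (use that in \<open>auto intro!: continuous_intros continuous_on_compose2[OF cont]\<close>)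
    then show ?thesis by (simp add: A0 algebra_simps)
  qed
  \<comment> \<open>Subtracting \<open>c\<close> from the lift moves the point at which the
    Hamiltonian is differentiated, and periodicity makes this harmless.\<close>
  have shift: "frechet_derivative (\<lambda>w. F t (torus_proj w)) (at (z - c)) v =
      frechet_derivative (\<lambda>w. F t (torus_proj w)) (at z) v" for t z v
    using iterated_deriv_translate[of "\<lambda>w. F t (torus_proj w)" "- c" 0 "[v]" z] smooth_slice[OF F, of t]
      torus_proj_add[OF lattice_minus[OF c]] by simp
  have "ham_lift F \<alpha> (\<lambda>p. A p - c)"
    unfolding ham_lift_def
  proof (intro conjI ballI allI)
    show "smooth (\<lambda>p. A p - c)" by (intro smooth_diff sA smooth_const)
    fix t :: real and z assume t: "t \<in> {0..1}"
    show "\<alpha> t (torus_proj z) = torus_proj (A (t, z) - c)"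
      using A t torus_proj_add[OF lattice_minus[OF c], of "A (t, z)"] by (simp add: ham_lift_def)
    have "vector_derivative (\<lambda>s. A (s, z) - c) (at t) = vector_derivative (\<lambda>s. A (s, z)) (at t)"
      using has_vector_derivative_diff[OF smooth_time_slice[OF sA] has_vector_derivative_const[of c], of z t]
      unfolding vector_derivative_at[OF smooth_time_slice[OF sA]] by (simp add: vector_derivative_at)
    then show "is_ham_vector (F t) (A (t, z) - c) (vector_derivative (\<lambda>s. A (s, z) - c) (at t))"
      using A t by (simp add: ham_lift_def is_ham_vector_def shift)
  qed
  then show ?thesis by (rule that) (auto simp: A0 equivariant_def eq)
qed

text \<open>The covering \<open>z \<mapsto> k z\<close> multiplies \<open>\<omega>\<close> by \<open>k\<^sup>2\<close>, whence the factor in front of the pulled back Hamiltonian.\<close>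

lemma generates_covering:
  fixes F :: "real \<Rightarrow> 'n::finite torus \<Rightarrow> real"
  assumes "generates F \<alpha>" "\<alpha> 0 = id" "k > 0"
  obtains B \<beta> where "continuous_on UNIV B" "\<And>z. \<alpha> 1 (torus_proj z) = torus_proj (B z)"
    "generates (\<lambda>t p. inverse (real k ^ 2) * F t (torus_mult k p)) \<beta>" "\<beta> 0 = id"
    "\<And>z. \<beta> 1 (torus_proj z) = torus_proj (inverse (real k) *\<^sub>R B (real k *\<^sub>R z))"
proof -
  obtain A where A: "ham_lift F \<alpha> A" and A0: "\<And>z. A (0, z) = z"
    and eq: "\<And>t. t \<in> {0..1} \<Longrightarrow> equivariant (\<lambda>z. A (t, z))"
    using ham_lift_normalized[OF assms(1,2)] by blast
  have sA: "smooth A" using A by (simp add: ham_lift_def)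
  have F: "smooth (\<lambda>(t, z). F t (torus_proj z))" using assms(1) by (simp add: generates_def)
  define \<beta> where "\<beta> t = torus_map (\<lambda>z. inverse (real k) *\<^sub>R A (t, real k *\<^sub>R z))" for t
  have \<beta>: "\<beta> t (torus_proj z) = torus_proj (inverse (real k) *\<^sub>R A (t, real k *\<^sub>R z))" if "t \<in> {0..1}" for t z
  proof -
    \<comment> \<open>The dilation sends \<open>m\<close> to the lattice vector \<open>k m\<close>,
      and the factor \<open>inverse (real k)\<close> turns the resulting displacement back into
      \<open>m\<close>.\<close>
    have "A (t, real k *\<^sub>R (z + m)) = A (t, real k *\<^sub>R z) + real k *\<^sub>R m" if "m \<in> lattice" for z m
      using eq[OF \<open>t \<in> {0..1}\<close>] lattice_scale[OF that, of "real k"]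
      by (simp add: equivariant_def scaleR_add_right)
    then have "equivariant (\<lambda>z. inverse (real k) *\<^sub>R A (t, real k *\<^sub>R z))"
      using assms(3) by (simp add: equivariant_def scaleR_add_right)
    then show ?thesis unfolding \<beta>_def by (rule equivariant_torus_map)
  qed
  let ?r = "\<lambda>p :: real \<times> 'n phase_space. (fst p, real k *\<^sub>R snd p)"
  let ?F = "\<lambda>t p. inverse (real k ^ 2) * F t (torus_mult k p)"
  have r: "smooth ?r" by (intro smooth_intros)
  have "smooth (\<lambda>p. inverse (real k ^ 2) * (\<lambda>(t, z). F t (torus_proj z)) (?r p))"
    by (intro smooth_mult smooth_const smooth_compose[OF F r])
  then have "smooth (\<lambda>(t, z). ?F t (torus_proj z))"
    by (simp only: case_prod_unfold fst_conv snd_conv torus_mult_proj)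
  moreover have "ham_lift ?F \<beta> (\<lambda>p. inverse (real k) *\<^sub>R A (?r p))"
    unfolding ham_lift_def
  proof (intro conjI ballI allI)
    show "smooth (\<lambda>p. inverse (real k) *\<^sub>R A (?r p))"
      by (intro smooth_scaleR smooth_const smooth_compose[OF sA r])
    fix t :: real and z assume t: "t \<in> {0..1}"
    show "\<beta> t (torus_proj z) = torus_proj (inverse (real k) *\<^sub>R A (?r (t, z)))"
      using \<beta>[OF t] by simp
    have vd: "vector_derivative (\<lambda>s. inverse (real k) *\<^sub>R A (?r (s, z))) (at t) =
        inverse (real k) *\<^sub>R vector_derivative (\<lambda>s. A (s, real k *\<^sub>R z)) (at t)"
      using has_vector_derivative_scaleR[OF DERIV_const smooth_time_slice[OF sA], of "inverse (real k)" "real k *\<^sub>R z" t]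
      unfolding vector_derivative_at[OF smooth_time_slice[OF sA]] by (simp add: vector_derivative_at)
    \<comment> \<open>The chain rule contributes a factor \<open>k\<close>, so \<open>1/k^2\<close>
      becomes \<open>1/k\<close>, the same factor as in the velocity of the rescaled lift.\<close>
    have fd: "frechet_derivative (\<lambda>w. ?F t (torus_proj w)) (at (inverse (real k) *\<^sub>R y)) v =
        inverse (real k) * frechet_derivative (\<lambda>w. F t (torus_proj w)) (at y) v" for y v
    proof -
      let ?G = "\<lambda>w. F t (torus_proj w)"
      have sG: "smooth ?G" using smooth_slice[OF F, of t] by simp
      have lin: "linear (frechet_derivative ?G (at y))"
        by (rule linear_frechet_derivative[OF smooth_differentiable[OF sG]])
      have "((\<lambda>w. real k *\<^sub>R w) has_derivative (\<lambda>w. real k *\<^sub>R w)) (at (inverse (real k) *\<^sub>R y))"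
        by (auto intro!: derivative_eq_intros)
      from has_derivative_mult_right[OF diff_chain_at[OF this smooth_has_derivative[OF sG]], of "inverse (real k ^ 2)"]
      have "frechet_derivative (\<lambda>w. ?F t (torus_proj w)) (at (inverse (real k) *\<^sub>R y)) v =
          inverse (real k ^ 2) * frechet_derivative ?G (at y) (real k *\<^sub>R v)"
        using assms(3) by (simp add: torus_mult_proj o_def frechet_derivative_at[symmetric])
      then show ?thesis
        using assms(3) by (simp add: linear_scale[OF lin] power2_eq_square)
    qed
    show "is_ham_vector (?F t) (inverse (real k) *\<^sub>R A (?r (t, z)))
        (vector_derivative (\<lambda>s. inverse (real k) *\<^sub>R A (?r (s, z))) (at t))"
      using A t unfolding vd by (simp add: is_ham_vector_def ham_lift_def omega.scaleR_left fd)
  qed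
  ultimately have gen: "generates ?F \<beta>" unfolding generates_iff by blast
  show ?thesis
  proof (rule that[of "\<lambda>z. A (1, z)" \<beta>, OF _ _ gen])
    show "continuous_on UNIV (\<lambda>z. A (1, z))" by (intro smooth_continuous smooth_slice sA)
    show "\<alpha> 1 (torus_proj z) = torus_proj (A (1, z))" for z using A by (simp add: ham_lift_def)
    show "\<beta> 0 = id" using \<beta>[of 0] assms(3) by (intro torus_eqI) (simp add: A0)
    show "\<beta> 1 (torus_proj z) = torus_proj (inverse (real k) *\<^sub>R A (1, real k *\<^sub>R z))" for z
      using \<beta>[of 1 z] by simp
  qed
qed

section \<open>Lengths of paths and the Finsler distance\<close>

definition admissible ::
  "(('n::finite torus \<Rightarrow> real) \<Rightarrow> real) \<Rightarrow> (real \<Rightarrow> 'n torus \<Rightarrow> real) \<Rightarrow> (real \<Rightarrow> 'n torus \<Rightarrow> 'n torus) \<Rightarrow> bool"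
where
  "admissible N F \<alpha> \<longleftrightarrow> generates F \<alpha> \<and> (\<forall>t\<in>{0..1}. \<alpha> t \<in> Ham \<and> F t \<in> normalized_functions) \<and>
     (\<lambda>t. N (F t)) integrable_on {0..1}"

lemma finsler_dist_eq:
  "finsler_dist N f g = Inf {path_length N F | F \<alpha>. admissible N F \<alpha> \<and> \<alpha> 0 = f \<and> \<alpha> 1 = g}"
  unfolding finsler_dist_def admissible_def by (rule arg_cong[of _ _ Inf]) blast

lemma finsler_dist_le:
  assumes "is_norm N" "admissible N F \<alpha>"
  shows "finsler_dist N (\<alpha> 0) (\<alpha> 1) \<le> path_length N F"
  unfolding finsler_dist_eq
proof (rule cInf_lower)
  show "bdd_below {path_length N G | G \<beta>. admissible N G \<beta> \<and> \<beta> 0 = \<alpha> 0 \<and> \<beta> 1 = \<alpha> 1}"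
  proof (rule bdd_belowI[of _ 0])
    fix x assume "x \<in> {path_length N G | G \<beta>. admissible N G \<beta> \<and> \<beta> 0 = \<alpha> 0 \<and> \<beta> 1 = \<alpha> 1}"
    then obtain G \<beta> where "admissible N G \<beta>" "x = path_length N G" by blast
    then show "0 \<le> x" using assms(1)
      unfolding path_length_def admissible_def is_norm_def by (auto intro!: integral_nonneg)
  qed
qed (use assms(2) in blast)

text \<open>
  A nearly shortest path need not be homotopic to any given one, so its lift to the covering is only known
  to end at a deck translate \<open>l / k\<close> of the expected map.
\<close>

lemma finsler_covering:
  fixes N :: "('n::finite torus \<Rightarrow> real) \<Rightarrow> real"
  assumes N: "is_norm N" "chi_invariant N"
    and path: "admissible N F0 \<alpha>0" "\<alpha>0 0 = id" "\<alpha>0 1 = g"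
    and L: "finsler_dist N id g < L"
    and \<Phi>: "continuous_on UNIV \<Phi>" "\<And>z. g (torus_proj z) = torus_proj (\<Phi> z)"
    and k: "k > 0"
  obtains h l where "h \<in> Ham" "l \<in> lattice"
    "\<And>z. h (torus_proj z) = torus_proj (inverse (real k) *\<^sub>R (\<Phi> (real k *\<^sub>R z) + l))"
    "finsler_dist N id h \<le> L / real k ^ 2"
proof -
  have "{path_length N F | F \<alpha>. admissible N F \<alpha> \<and> \<alpha> 0 = id \<and> \<alpha> 1 = g} \<noteq> {}"
    using path by blast
  \<comment> \<open>A path of length below \<open>L\<close> exists because \<open>L\<close> strictly
    exceeds the infimum, whose set of lengths contains that of the given path.\<close>
  from cInf_lessD[OF this L[unfolded finsler_dist_eq]]
  obtain F \<alpha> where F: "admissible N F \<alpha>" "\<alpha> 0 = id" "\<alpha> 1 = g" "path_length N F < L"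
    by blast
  let ?G = "\<lambda>t p. inverse (real k ^ 2) * F t (torus_mult k p)"
  obtain B \<beta> where B: "continuous_on UNIV B" "\<And>z. \<alpha> 1 (torus_proj z) = torus_proj (B z)"
    and \<beta>: "generates ?G \<beta>" "\<beta> 0 = id"
      "\<And>z. \<beta> 1 (torus_proj z) = torus_proj (inverse (real k) *\<^sub>R B (real k *\<^sub>R z))"
    using generates_covering[of F \<alpha> k] F(1,2) k unfolding admissible_def by blast
  have norm: "?G t \<in> normalized_functions" "N (?G t) = inverse (real k ^ 2) * N (F t)" if "t \<in> {0..1}" for t
  proof -
    have Ft: "F t \<in> normalized_functions" using F(1) that by (simp add: admissible_def)
    note m = normalized_torus_mult[OF Ft k]
    show "?G t \<in> normalized_functions" by (rule normalized_cmult[OF m(1)])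
    \<comment> \<open>Here \<chi>-invariance enters: the pullback has the same distribution as
      \<open>F t\<close>, hence the same norm.\<close>
    have "N (\<lambda>p. F t (torus_mult k p)) = N (F t)"
      using N(2) m Ft unfolding chi_invariant_def by blast
    moreover have "N (?G t) = \<bar>inverse (real k ^ 2)\<bar> * N (\<lambda>p. F t (torus_mult k p))"
    proof -
      have "\<forall>H\<in>normalized_functions. \<forall>c. N (\<lambda>p. c * H p) = \<bar>c\<bar> * N H"
        using N(1) unfolding is_norm_def by blast
      from this[rule_format, OF m(1)] show ?thesis .
    qed
    ultimately show "N (?G t) = inverse (real k ^ 2) * N (F t)" by simp
  qed
  have int: "((\<lambda>t. N (?G t)) has_integral inverse (real k ^ 2) * path_length N F) {0..1}"
  proof (rule has_integral_eq[OF norm(2)[symmetric]])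
    show "((\<lambda>t. inverse (real k ^ 2) * N (F t)) has_integral inverse (real k ^ 2) * path_length N F) {0..1}"
      unfolding path_length_def
      by (intro has_integral_mult_right integrable_integral) (use F(1) in \<open>simp add: admissible_def\<close>)
  qed
  have "admissible N ?G \<beta>"
    using \<beta> norm int Ham_pathI[OF \<beta>(1,2)] unfolding admissible_def by (auto simp: integrable_on_def)
  from finsler_dist_le[OF N(1) this] have "finsler_dist N id (\<beta> 1) \<le> inverse (real k ^ 2) * path_length N F"
    using int by (simp add: \<beta>(2) path_length_def integral_unique)
  also have "\<dots> \<le> L / real k ^ 2"
    using F(4) k by (simp add: field_simps)
  finally have le: "finsler_dist N id (\<beta> 1) \<le> L / real k ^ 2" .
  have lat: "B z - \<Phi> z \<in> lattice" for z
    using B(2) \<Phi>(2) F(3) by (simp add: torus_proj_eq_iff[symmetric])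
  \<comment> \<open>\<open>B\<close> and \<open>\<Phi>\<close> both lift \<open>g\<close>, so they
    differ by one fixed lattice vector, read off at the origin.\<close>
  define l where "l = B 0 - \<Phi> 0"
  have Bz: "B z = \<Phi> z + l" for z
  proof -
    have "B z - \<Phi> z = B 0 - \<Phi> 0"
      by (rule lattice_valued_constant[of UNIV "\<lambda>z. B z - \<Phi> z"])
        (auto intro!: continuous_intros B \<Phi> lat)
    then show ?thesis by (simp add: l_def algebra_simps)
  qed
  have "\<beta> 1 \<in> Ham" by (rule Ham_pathI[OF \<beta>(1,2)]) simp
  moreover have "l \<in> lattice" unfolding l_def by (rule lat)
  ultimately show ?thesis
    using \<beta>(3)[unfolded Bz] le by (rule that)
qed

text \<open>The Hamiltonian \<open>V (omega e z)\<close> is constant along the direction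
  \<open>e\<close>, so its flow moves points along \<open>e\<close> at constant speed. A periodic
  antiderivative \<open>V\<close> makes it a function on the torus; subtracting the mean normalizes
  it.\<close>

lemma autonomous_shear_path:
  fixes N :: "('n::finite torus \<Rightarrow> real) \<Rightarrow> real"
  assumes e: "e \<in> lattice" and V: "profile V" "\<And>t. (V has_real_derivative f t) (at t)" and f: "profile f"
  obtains F \<alpha> where "admissible N F \<alpha>" "\<alpha> 0 = id" "\<alpha> 1 = tshear e f"
proof -
  let ?V = "\<lambda>p :: 'n torus. V (omega e (torus_rep p))"
  have V_proj: "?V (torus_proj z) = V (omega e z)" for z
  proof -
    have "torus_rep (torus_proj z) - z \<in> lattice"
      by (simp add: torus_proj_eq_iff[symmetric] torus_proj_rep)
    from omega_lattice[OF e this] show ?thesis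
      using profile_Ints[OF V(1), of "omega e (torus_rep (torus_proj z) - z)" "omega e z"]
      by (simp add: omega.diff_right)
  qed
  have sV: "smooth V" "smooth f" using V f by (auto simp: profile_def)
  have sVp: "smooth (\<lambda>z. ?V (torus_proj z))"
    unfolding V_proj by (intro smooth_compose[OF sV(1)] smooth_intros)
  obtain c where c: "(\<lambda>p. ?V p - c) \<in> normalized_functions" by (rule normalize[OF sVp])
  define F where "F = (\<lambda>(t::real) p. ?V p - c)"
  define \<alpha> where "\<alpha> t = tshear e (\<lambda>s. t * f s)" for t
  define A where "A = (\<lambda>p :: real \<times> 'n phase_space. snd p + (fst p * f (omega e (snd p))) *\<^sub>R e)"
  have "smooth (\<lambda>p :: real \<times> 'n phase_space. V (omega e (snd p)) - c)"
    by (intro smooth_diff smooth_const smooth_compose[OF sV(1)] smooth_intros)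
  then have "smooth (\<lambda>(t, z). F t (torus_proj z))"
    by (simp only: F_def V_proj case_prod_unfold)
  moreover have "ham_lift F \<alpha> A"
    unfolding ham_lift_def
  proof (intro conjI ballI allI)
    show "smooth A" unfolding A_def by (intro smooth_intros smooth_compose[OF sV(2)])
    fix t z
    show "\<alpha> t (torus_proj z) = torus_proj (A (t, z))"
      using tshear_proj[OF e profile_scale[OF f], of t z] by (simp add: \<alpha>_def A_def shear_def)
    have "((\<lambda>s. A (s, z)) has_vector_derivative f (omega e z) *\<^sub>R e) (at t)"
      unfolding A_def by (auto intro!: derivative_eq_intros simp: scaleR_scaleR[symmetric] simp del: scaleR_scaleR)
    then have vd: "vector_derivative (\<lambda>s. A (s, z)) (at t) = f (omega e z) *\<^sub>R e"
      by (rule vector_derivative_at)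
    have A: "omega e (A (t, z)) = omega e z"
      by (simp add: A_def omega.add_right omega.scaleR_right)
    have "((\<lambda>w. V (omega e w) - c) has_derivative (\<lambda>v. f (omega e y) * omega e v)) (at y)" for y
      using diff_chain_at[OF bounded_linear_imp_has_derivative[OF omega.bounded_linear_right[of e]]
          V(2)[unfolded has_field_derivative_def], of y]
      by (auto intro!: derivative_eq_intros simp: o_def)
    from frechet_derivative_at[OF this, symmetric]
    show "is_ham_vector (F t) (A (t, z)) (vector_derivative (\<lambda>s. A (s, z)) (at t))"
      unfolding is_ham_vector_def F_def V_proj vd by (simp add: A omega.scaleR_left)
  qed
  ultimately have gen: "generates F \<alpha>" unfolding generates_iff by blast
  have \<alpha>01: "\<alpha> 0 = id" "\<alpha> 1 = tshear e f" by (simp_all add: \<alpha>_def tshear_0)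
  have "admissible N F \<alpha>"
    using gen c Ham_pathI[OF gen \<alpha>01(1)] by (simp add: admissible_def F_def integrable_const_ivl)
  then show ?thesis using \<alpha>01 by (rule that)
qed

section \<open>Bi-invariant metrics on the group of shears\<close>

locale biinvariant_group =
  fixes G :: "('a \<Rightarrow> 'a) set" and D :: "('a \<Rightarrow> 'a) \<Rightarrow> ('a \<Rightarrow> 'a) \<Rightarrow> real"
  assumes id_in: "id \<in> G" and comp_in: "f \<in> G \<Longrightarrow> g \<in> G \<Longrightarrow> f \<circ> g \<in> G"
    and metric: "Metric_space G D"
    and left: "f \<in> G \<Longrightarrow> g \<in> G \<Longrightarrow> h \<in> G \<Longrightarrow> D (h \<circ> f) (h \<circ> g) = D f g"
    and right: "f \<in> G \<Longrightarrow> g \<in> G \<Longrightarrow> h \<in> G \<Longrightarrow> D (f \<circ> h) (g \<circ> h) = D f g"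
begin

interpretation Metric_space G D by (rule metric)

lemma dist_comp:
  assumes "a \<in> G" "b \<in> G" "c \<in> G" "d \<in> G"
  shows "D (a \<circ> b) (c \<circ> d) \<le> D a c + D b d"
  using triangle[of "a \<circ> b" "c \<circ> b" "c \<circ> d"] assms by (simp add: comp_in left right)

lemma funpow_in: "a \<in> G \<Longrightarrow> a ^^ n \<in> G"
  by (induction n) (simp_all add: id_in[unfolded id_def] id_in comp_in)

lemma dist_funpow:
  assumes "a \<in> G" "b \<in> G"
  shows "D (a ^^ n) (b ^^ n) \<le> real n * D a b"
proof (induction n)
  case 0
  show ?case by (simp only: funpow.simps(1) mdist_zero[OF id_in] of_nat_0 mult_zero_left order_refl)
next
  case (Suc n)
  have "D (a ^^ Suc n) (b ^^ Suc n) \<le> D a b + D (a ^^ n) (b ^^ n)"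
    using dist_comp[OF assms(1) funpow_in[OF assms(1)] assms(2) funpow_in[OF assms(2)]]
    by (simp only: funpow.simps(2))
  with Suc show ?case by (simp only: of_nat_Suc ring_distribs mult_1_left)
qed

lemma dist_conj:
  assumes "s \<in> G" "s' \<in> G" "a \<in> G" "b \<in> G"
  shows "D (s \<circ> a \<circ> s') (s \<circ> b \<circ> s') = D a b"
  using assms by (simp add: left right comp_in)

text \<open>Both products lie within \<open>D a id\<close> of \<open>b\<close>.\<close>

lemma dist_commutator:
  assumes "a \<in> G" "b \<in> G"
  shows "D (a \<circ> b) (b \<circ> a) \<le> 2 * D a id"
proof -
  have "D (a \<circ> b) (b \<circ> a) \<le> D (a \<circ> b) (id \<circ> b) + D (b \<circ> id) (b \<circ> a)"
    using triangle[of "a \<circ> b" b "b \<circ> a"] assms by (simp add: comp_in)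
  also have "\<dots> = 2 * D a id"
    using left[OF id_in assms] right[OF assms(1) id_in assms(2)] by (simp add: commute)
  finally show ?thesis .
qed

text \<open>The last hypothesis says that \<open>s\<close> is the commutator of \<open>b\<close> and
  \<open>a\<close>, written without inverses. The bound does not depend on \<open>a\<close>, however
  large it is.\<close>

lemma dist_id_le_of_commutator:
  assumes "s \<in> G" "a \<in> G" "b \<in> G" "s \<circ> a \<circ> b = b \<circ> a"
  shows "D s id \<le> 2 * D b id"
proof -
  have "D s id = D (s \<circ> (a \<circ> b)) (id \<circ> (a \<circ> b))"
    using assms id_in by (intro right[symmetric] comp_in)
  also have "\<dots> = D (b \<circ> a) (a \<circ> b)" using assms(4) by (simp add: comp_assoc)
  also have "\<dots> \<le> 2 * D b id" by (rule dist_commutator[OF assms(3,2)])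
  finally show ?thesis .
qed

text \<open>Replacing \<open>g\<close> and \<open>h\<close> by the commuting maps \<open>e\<close>
  and \<open>e'\<close> costs \<open>D g e + D h e'\<close> in each of the two products.\<close>

lemma dist_commute_approx:
  assumes "g \<in> G" "h \<in> G" "e \<in> G" "e' \<in> G" "e \<circ> e' = e' \<circ> e"
  shows "D (g \<circ> h) (h \<circ> g) \<le> 2 * (D g e + D h e')"
proof -
  have "D (g \<circ> h) (h \<circ> g) \<le> D (g \<circ> h) (e \<circ> e') + D (h \<circ> g) (e' \<circ> e)"
    using triangle[of "g \<circ> h" "e \<circ> e'" "h \<circ> g"] assms by (simp add: comp_in commute)
  also have "\<dots> \<le> (D g e + D h e') + (D h e' + D g e)"
    by (intro add_mono dist_comp assms)
  finally show ?thesis by simp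
qed

end

section \<open>Disjoint supports, antiperiodic functions and powers of shears\<close>

text \<open>An injective map preserves its support: if \<open>f x\<close> were outside
  \<open>A\<close>, it would be a fixed point, and injectivity would give \<open>f x = x\<close>. So
  each map acts as the identity where the other one moves points.\<close>

lemma disjoint_support_commute:
  assumes "inj f" "inj g" "\<And>x. x \<notin> A \<Longrightarrow> f x = x" "\<And>x. x \<notin> B \<Longrightarrow> g x = x" "A \<inter> B = {}"
  shows "f \<circ> g = g \<circ> f"
proof
  fix x
  have f: "f x \<in> A" if "x \<in> A" for x using that assms(1,3) by (metis injD)
  have g: "g x \<in> B" if "x \<in> B" for x using that assms(2,4) by (metis injD)
  show "(f \<circ> g) x = (g \<circ> f) x"
    using assms(3)[of x] assms(3)[of "g x"] assms(4)[of x] assms(4)[of "f x"] f[of x] g[of x] assms(5)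
    by (cases "x \<in> A"; cases "x \<in> B") (auto simp: disjoint_iff)
qed

lemma funpow_fixpoint: "f x = x \<Longrightarrow> (f ^^ n) x = x"
  by (induction n) auto

text \<open>By antiperiodicity \<open>V (t + 1/2) + V t\<close> has derivative 0 and is constant;
  comparing its values half a period apart gives period 1.\<close>

lemma antiperiodic_antiderivative:
  assumes v: "profile v" "\<And>t. v (t + 1/2) = - v t"
  obtains V where "profile V" "\<And>t. (V has_real_derivative v t) (at t)"
proof -
  have "continuous_on UNIV v" using v(1) by (simp add: profile_def smooth_continuous)
  then have "\<exists>V. \<forall>t. - \<infinity> < ereal t \<longrightarrow> ereal t < \<infinity> \<longrightarrow> (V has_vector_derivative v t) (at t)"
    by (intro einterval_antiderivative) (auto simp: continuous_on_eq_continuous_at)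
  then obtain V where V: "\<And>t. (V has_real_derivative v t) (at t)"
    by (auto simp: has_real_derivative_iff_has_vector_derivative)
  have "((\<lambda>t. V (t + 1/2) + V t) has_real_derivative 0) (at t)" for t
    using v(2)[of t] by (auto intro!: derivative_eq_intros DERIV_chain2[OF V])
  then have const: "V (t + 1/2) + V t = V (s + 1/2) + V s" for s t
    using DERIV_isconst_all[of "\<lambda>t. V (t + 1/2) + V t"] by blast
  have "V (t + 1) = V t" for t
    using const[of "t + 1/2" t] by (simp add: add.commute)
  moreover have "smooth V" by (rule smooth_real[OF V]) (use v(1) in \<open>simp add: profile_def\<close>)
  ultimately show ?thesis using V that by (auto simp: profile_def)
qed

lemma smooth_trig: "smooth (\<lambda>t. sin (2 * pi * t))" "smooth (\<lambda>t. cos (2 * pi * t))"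
  by (intro smooth_compose[OF smooth_sin] smooth_compose[OF smooth_cos] smooth_intros)+

lemma profile_sin: "profile (\<lambda>t. sin (2 * pi * t))" and profile_cos: "profile (\<lambda>t. cos (2 * pi * t))"
  by (simp_all add: profile_def smooth_trig ring_distribs)

text \<open>Compose the odd step with the sine, which changes sign after half a period. The values
  1/2 and -1/2 agree modulo 1, which is all that the torus sees.\<close>

lemma antiperiodic_step:
  obtains w where "profile w" "\<And>t. w (t + 1/2) = - w t"
    "\<And>t. \<bar>sin (2 * pi * t)\<bar> \<ge> 1/4 \<Longrightarrow> w t - 1/2 \<in> \<int>"
proof -
  obtain B :: "real \<Rightarrow> real" where B: "smooth B" "\<And>t. B (- t) = - B t" "\<And>t. t \<ge> 1/4 \<Longrightarrow> B t = 1/2"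
    using smooth_step_exists by blast
  let ?w = "\<lambda>t. B (sin (2 * pi * t))"
  show ?thesis
  proof (rule that[of ?w])
    show "profile ?w" using profile_sin by (simp add: profile_def smooth_compose[OF B(1)])
    show "?w (t + 1/2) = - ?w t" for t
    proof -
      have "2 * pi * (t + 1/2) = 2 * pi * t + pi" by (simp add: algebra_simps)
      then show ?thesis by (simp add: B(2) del: distrib_left_numeral)
    qed
    show "?w t - 1/2 \<in> \<int>" if "\<bar>sin (2 * pi * t)\<bar> \<ge> 1/4" for t
    proof (cases "sin (2 * pi * t) \<ge> 0")
      case True
      then have "?w t = 1/2" using that by (intro B(3)) simp
      then show ?thesis by (simp only: diff_self Ints_0)
    next
      case False
      then have "?w t = - 1/2" using that B(3)[of "- sin (2 * pi * t)"] B(2)[of "sin (2 * pi * t)"] by simp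
      then show ?thesis by simp
    qed
  qed
qed

lemma sin_lipschitz: "\<bar>sin x - sin y\<bar> \<le> \<bar>x - y\<bar>" for x y :: real
proof -
  have "norm (sin x - sin y) \<le> 1 * norm (x - y)"
    by (rule field_differentiable_bound[of UNIV sin cos]) (auto intro: DERIV_sin)
  then show ?thesis by simp
qed

lemma tshear_funpow:
  assumes "e \<in> lattice" "profile f"
  shows "tshear e f ^^ n = tshear e (\<lambda>t. real n * f t)"
proof (induction n)
  case 0
  then show ?case by (simp add: tshear_0)
next
  case (Suc n)
  have "tshear e f ^^ Suc n = tshear e f \<circ> tshear e (\<lambda>t. real n * f t)" using Suc by simp
  also have "\<dots> = tshear e (\<lambda>t. real (Suc n) * f t)"
    using assms by (simp add: tshear_comp profile_scale algebra_simps)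
  finally show ?case .
qed

section \<open>Estimates for shears in two conjugate directions\<close>

locale shear_metric =
  biinvariant_group shear_group D for D :: "('n::finite torus \<Rightarrow> 'n torus) \<Rightarrow> ('n torus \<Rightarrow> 'n torus) \<Rightarrow> real" +
  fixes e1 e2 :: "'n phase_space"
  assumes e: "e1 \<in> lattice" "e2 \<in> lattice" "omega e1 e2 = 1"
begin

interpretation Metric_space shear_group D by (rule metric)

lemma omega21: "omega e2 e1 = -1"
  using e(3) omega_commute[of e1 e2] by simp

lemmas in_group = shear_group_comp shear_group_tshear profile_const profile_scale profile_minus e

text \<open>Conjugation by the half-period translation along \<open>e2\<close> shifts
  \<open>omega e1\<close> by 1/2 and flips the sign of \<open>v\<close>. The commutator of this
  translation with the shear of profile \<open>- c/2 * v\<close> therefore has profile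
  \<open>c * v\<close>, whatever the size of \<open>c\<close>.\<close>

lemma shear_defect_le:
  assumes v: "profile v" "\<And>t. v (t + 1/2) = - v t"
  shows "D id (tshear e1 (\<lambda>t. c * v t)) \<le> 2 * D (tshear e2 (\<lambda>_. 1/2)) id"
proof -
  let ?a = "tshear e1 (\<lambda>t. (- c / 2) * v t)" and ?b = "tshear e2 (\<lambda>_. 1/2)" and ?s = "tshear e1 (\<lambda>t. c * v t)"
  have "?s \<circ> ?a \<circ> ?b = ?b \<circ> ?a"
    by (rule torus_eqI)
      (simp only: o_apply tshear_proj e v(1) profile_const profile_scale, rule arg_cong[of _ _ torus_proj],
       simp add: shear_def omega.add_right omega.diff_right omega.minus_right omega.scaleR_right e(3) omega21 v(2)
         algebra_simps scaleR_left_distrib[symmetric])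
  then show ?thesis
    using dist_id_le_of_commutator[of ?s ?a ?b] shear_group_tshear[OF e(1) profile_scale[OF v(1)]]
      shear_group_tshear[OF e(2) profile_const] by (simp only: commute[of id])
qed

text \<open>
  Conjugation by the half-period translation inverts the shear and fixes every translation, so the
  commutator with it doubles the shear and removes the unknown deck translation by \<open>l / k\<close>.
\<close>

lemma covering_defect_le:
  assumes v: "profile v" "\<And>t. v (t + 1/2) = - v t" and k: "k > 0" and l: "l \<in> lattice"
    and h: "\<And>z. h (torus_proj z) = torus_proj (inverse (real k) *\<^sub>R (shear e1 (\<lambda>t. real k * v t) (real k *\<^sub>R z) + l))"
  shows "h \<in> shear_group" "D (tshear e1 (\<lambda>t. 2 * v (real k * t))) id \<le> 2 * D h id"
proof -
  let ?v = "\<lambda>t. v (real k * t)"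
  \<comment> \<open>Half a period of the fast profile is \<open>1 / (2 k)\<close>, which fixes the
    translation \<open>?b\<close>.\<close>
  let ?s = "tshear e1 (\<lambda>t. 2 * v (real k * t))" and ?b = "tshear e2 (\<lambda>_. inverse (2 * real k))"
  have pv: "profile ?v" by (rule profile_rescale[OF v(1)])
  have inv: "inverse (real k) * (real k * x) = x" for x using k by simp
  have h_eq: "h = tshear l (\<lambda>_. inverse (real k)) \<circ> tshear e1 ?v"
    using k by (intro torus_eqI)
      (simp add: h tshear_proj e l pv profile_const shear_def omega.scaleR_right scaleR_add_right add_ac inv)
  then show hG: "h \<in> shear_group" using l pv by (simp add: in_group)
  have anti: "v (x + (1/2 + n)) = - v x" if "n \<in> \<int>" for x n
    using profile_Ints[OF v(1) that, of "x + 1/2"] v(2)[of x] by (simp add: add.assoc)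
  have "?s \<circ> ?b \<circ> h = h \<circ> ?b"
  proof (rule torus_eqI)
    fix z
    let ?X = "z + ?v (omega e1 z) *\<^sub>R e1 + inverse (real k) *\<^sub>R l + inverse (2 * real k) *\<^sub>R e2"
    \<comment> \<open>After scaling by \<open>k\<close> the deck translation shifts the argument by
      the integer \<open>omega e1 l\<close>, which \<open>v\<close> does not see; the remaining 1/2
      flips its sign.\<close>
    have "real k * omega e1 ?X = real k * omega e1 z + (1/2 + omega e1 l)"
      using k by (simp add: omega.add_right omega.scaleR_right e(3) field_simps)
    then have X: "?v (omega e1 ?X) = - ?v (omega e1 z)"
      using anti[OF omega_lattice[OF e(1) l]] by simp
    have 1: "real k * (omega e1 z + inverse (2 * real k)) = real k * omega e1 z + 1/2"
      "real k * (omega e1 z + inverse (real k) / 2) = real k * omega e1 z + 1/2"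
      using k by (simp_all add: field_simps)
    have "(?s \<circ> ?b \<circ> h) (torus_proj z) = torus_proj (shear e1 (\<lambda>t. 2 * ?v t) (shear e2 (\<lambda>_. inverse (2 * real k))
        (shear l (\<lambda>_. inverse (real k)) (shear e1 ?v z))))"
      by (simp add: h_eq tshear_proj e l pv profile_const profile_scale)
    also have "shear e1 (\<lambda>t. 2 * ?v t) (shear e2 (\<lambda>_. inverse (2 * real k)) (shear l (\<lambda>_. inverse (real k)) (shear e1 ?v z)))
        = ?X + (2 * ?v (omega e1 ?X)) *\<^sub>R e1"
      by (simp only: shear_def)
    also have "\<dots> = z + (inverse (2 * real k)) *\<^sub>R e2 + inverse (real k) *\<^sub>R l + (- ?v (omega e1 z)) *\<^sub>R e1"
      unfolding X by (simp add: algebra_simps scaleR_left_distrib[symmetric])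
    also have "\<dots> = shear l (\<lambda>_. inverse (real k)) (shear e1 ?v (shear e2 (\<lambda>_. inverse (2 * real k)) z))"
      by (simp add: shear_def omega.add_right omega.scaleR_right e(3) 1 v(2))
    also have "torus_proj \<dots> = (h \<circ> ?b) (torus_proj z)"
      by (simp add: h_eq tshear_proj e l pv profile_const profile_scale)
    finally show "(?s \<circ> ?b \<circ> h) (torus_proj z) = (h \<circ> ?b) (torus_proj z)" .
  qed
  then show "D ?s id \<le> 2 * D h id"
    using dist_id_le_of_commutator[of ?s ?b h] hG pv by (simp add: in_group)
qed

text \<open>
  Write \<open>\<phi>\<close> for the translation by half a period and \<open>S = \<phi> \<theta>\<close> for the fast shear; \<open>\<theta>\<close> is the identity
  off the thin strips where \<open>w\<close> jumps. Since \<open>S\<close> is close to the identity, the commutator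
  \<open>[\<phi>, \<eta>]\<close> is close to \<open>g = [\<theta>\<inverse>, \<eta>]\<close>, which is supported near these strips if \<open>\<eta>\<close> is small.
\<close>

lemma fragment:
  fixes a :: real
  assumes w: "profile w" "\<And>t. \<bar>sin (2 * pi * t)\<bar> \<ge> 1/4 \<Longrightarrow> w t - 1/2 \<in> \<int>"
    and q: "profile q" "\<And>t. q (t + 1/2) = - q t" "\<And>t. \<bar>q t\<bar> \<le> 1 / (32 * real k)" and k: "k > 0"
  obtains g where "g \<in> shear_group" "D (tshear e2 (\<lambda>t. 2 * q t)) g \<le> 2 * D (tshear e1 (\<lambda>t. w (real k * t))) id"
    "\<And>z. \<bar>sin (2 * pi * (real k * omega e1 z + a))\<bar> \<ge> 1/2 \<Longrightarrow> g (torus_proj z) = torus_proj z"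
proof -
  let ?wa = "\<lambda>t. w (real k * t + a)"
  let ?R = "tshear e1 (\<lambda>t. w (real k * t))" and ?T = "tshear e2 (\<lambda>_. a / real k)"
  let ?S = "tshear e1 ?wa" and ?S' = "tshear e1 (\<lambda>t. - ?wa t)"
  let ?\<theta>f = "\<lambda>t. - (1/2) + ?wa t"
  let ?\<theta> = "tshear e1 ?\<theta>f" and ?\<theta>' = "tshear e1 (\<lambda>t. - ?\<theta>f t)"
  let ?\<eta> = "tshear e2 (\<lambda>t. - q t)" and ?\<eta>' = "tshear e2 q"
  let ?\<phi> = "tshear e1 (\<lambda>_. 1/2)" and ?\<phi>' = "tshear e1 (\<lambda>_. - (1/2))"
  have p0: "profile (\<lambda>t. w (real k * t))" by (rule profile_rescale[OF w(1)])
  have pa: "profile ?wa" using profile_rescale[OF profile_shift[OF w(1)]] .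
  have p\<theta>: "profile ?\<theta>f" by (rule profile_add[OF profile_const pa])
  note pr = p0 pa p\<theta> q(1) profile_minus profile_const
  \<comment> \<open>Moving the strips by the phase \<open>a\<close> is conjugation by a translation
    along \<open>e2\<close>, so \<open>?S\<close> is exactly as close to the identity as
    \<open>?R\<close>.\<close>
  have "?R \<circ> ?T = ?T \<circ> ?S"
    using k by (intro torus_eqI)
      (simp add: tshear_proj e pr, simp add: shear_def omega.add_right omega.scaleR_right e(3) ring_distribs algebra_simps)
  moreover have "D (?R \<circ> ?T) ?T = D ?R id"
    using right[of ?R id ?T] by (simp add: in_group pr id_in)
  moreover have "D (?T \<circ> ?S) ?T = D ?S id"
    using left[of ?S id ?T] by (simp add: in_group pr id_in)
  ultimately have DS: "D ?S id = D ?R id" by simp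
  have inv: "?S' \<circ> ?S = id" using tshear_inverse(2)[OF e(1) pa] .
  define g where "g = ?\<theta>' \<circ> ?\<eta> \<circ> (?\<theta> \<circ> ?\<eta>')"
  have mem: "?S \<in> shear_group" "?S' \<in> shear_group" "?\<theta> \<in> shear_group" "?\<theta>' \<in> shear_group"
    "?\<eta> \<in> shear_group" "?\<eta>' \<in> shear_group"
    by (intro shear_group_tshear e pr)+
  have gG: "g \<in> shear_group" unfolding g_def by (intro shear_group_comp mem)
  \<comment> \<open>Antiperiodicity of \<open>q\<close> makes the half-period translation
    \<open>?\<phi>\<close> invert \<open>?\<eta>\<close> under conjugation, so this commutator
    doubles \<open>q\<close>.\<close>
  have "tshear e2 (\<lambda>t. 2 * q t) = ?\<phi> \<circ> ?\<eta> \<circ> ?\<phi>' \<circ> ?\<eta>'"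
  proof (rule torus_eqI)
    fix z
    have "q (omega e2 z + 1/2) = - q (omega e2 z)" by (rule q(2))
    then show "tshear e2 (\<lambda>t. 2 * q t) (torus_proj z) = (?\<phi> \<circ> ?\<eta> \<circ> ?\<phi>' \<circ> ?\<eta>') (torus_proj z)"
      by (simp add: tshear_proj e pr profile_scale[OF q(1)])
         (simp add: shear_def omega.add_right omega.diff_right omega.scaleR_right omega21 algebra_simps scaleR_2 flip: scaleR_add_left)
  qed
  \<comment> \<open>The half-period translation splits into the fast shear and a factor that is
    trivial off the strips.\<close>
  moreover have "?\<phi> = ?\<theta>' \<circ> ?S" "?\<phi>' = ?S' \<circ> ?\<theta>"
    using tshear_comp[OF e(1) profile_minus[OF p\<theta>] pa] tshear_comp[OF e(1) profile_minus[OF pa] p\<theta>] by simp_all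
  ultimately have "tshear e2 (\<lambda>t. 2 * q t) = ?\<theta>' \<circ> (?S \<circ> ?\<eta> \<circ> ?S') \<circ> (?\<theta> \<circ> ?\<eta>')"
    by (simp add: comp_assoc)
  then have "D (tshear e2 (\<lambda>t. 2 * q t)) g = D (?S \<circ> ?\<eta> \<circ> ?S') ?\<eta>"
    unfolding g_def by (simp only:) (intro dist_conj shear_group_comp mem)
  also have "\<dots> \<le> 2 * D ?S id"
  proof -
    have "D (?S \<circ> ?\<eta> \<circ> ?S') ?\<eta> = D (?S \<circ> ?\<eta> \<circ> ?S' \<circ> ?S) (?\<eta> \<circ> ?S)"
      by (intro right[symmetric] shear_group_comp mem)
    also have "?S \<circ> ?\<eta> \<circ> ?S' \<circ> ?S = ?S \<circ> ?\<eta>" using inv by (simp add: comp_assoc)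
    also have "D (?S \<circ> ?\<eta>) (?\<eta> \<circ> ?S) \<le> 2 * D ?S id" by (intro dist_commutator mem)
    finally show ?thesis .
  qed
  finally have "D (tshear e2 (\<lambda>t. 2 * q t)) g \<le> 2 * D ?R id" using DS by simp
  moreover have "g (torus_proj z) = torus_proj z" if z: "\<bar>sin (2 * pi * (real k * omega e1 z + a))\<bar> \<ge> 1/2" for z
  proof -
    have \<theta>_fix: "?\<theta> (torus_proj y) = torus_proj y" "?\<theta>' (torus_proj y) = torus_proj y"
      if "\<bar>sin (2 * pi * (real k * omega e1 y + a))\<bar> \<ge> 1/4" for y
    proof -
      have "?\<theta>f (omega e1 y) \<in> \<int>" using w(2)[OF that] by (simp add: add.commute)
      from lattice_scale[OF e(1) this] lattice_scale[OF e(1) Ints_minus[OF this]]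
      have "?\<theta>f (omega e1 y) *\<^sub>R e1 \<in> lattice" "(- ?\<theta>f (omega e1 y)) *\<^sub>R e1 \<in> lattice" .
      then show "?\<theta> (torus_proj y) = torus_proj y" "?\<theta>' (torus_proj y) = torus_proj y"
        using p\<theta> profile_minus[OF p\<theta>] by (simp_all only: tshear_proj[OF e(1)] shear_def torus_proj_add)
    qed
    define y where "y = shear e2 q z"
    have "omega e1 y = omega e1 z + q (omega e2 z)"
      by (simp add: y_def shear_def omega.add_right omega.scaleR_right e(3))
    \<comment> \<open>The small shear changes the phase by at most \<pi>/16, which is below 1/4. So
      a sine of size at least 1/2 at \<open>z\<close> stays at least 1/4 at \<open>y\<close>, where
      \<open>?\<theta>\<close> still fixes the point.\<close>
    then have "\<bar>2 * pi * (real k * omega e1 z + a) - 2 * pi * (real k * omega e1 y + a)\<bar> = 2 * pi * real k * \<bar>q (omega e2 z)\<bar>"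
      by (simp add: algebra_simps abs_mult)
    also have "\<dots> \<le> 2 * pi * real k * (1 / (32 * real k))"
      by (intro mult_left_mono q(3)) auto
    also have "\<dots> \<le> 1/4" using k pi_less_4 by (simp add: field_simps)
    finally have "\<bar>sin (2 * pi * (real k * omega e1 y + a))\<bar> \<ge> 1/4"
      using sin_lipschitz[of "2 * pi * (real k * omega e1 z + a)" "2 * pi * (real k * omega e1 y + a)"] z by linarith
    then have "?\<theta> (torus_proj y) = torus_proj y" by (rule \<theta>_fix)
    moreover have "?\<eta>' (torus_proj z) = torus_proj y" by (simp add: y_def tshear_proj e q)
    moreover have "?\<eta> (torus_proj y) = torus_proj z"
      by (simp add: tshear_proj e pr) (simp add: y_def shear_def omega.add_right omega.scaleR_right)
    moreover have "?\<theta>' (torus_proj z) = torus_proj z" by (rule \<theta>_fix) (use z in linarith)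
    ultimately show ?thesis by (simp add: g_def)
  qed
  ultimately show ?thesis using gG that by blast
qed

text \<open>With \<open>r\<close> the distance of the fast shear from the identity, \<open>g\<close>
  is within \<open>8 k r\<close> of a map supported near the strips, and \<open>h\<close> within
  \<open>8 k r\<close> of one supported near the strips shifted by a quarter period. These two maps
  commute.\<close>

lemma shears_commute_approx:
  fixes k :: nat
  assumes w: "profile w" "\<And>t. \<bar>sin (2 * pi * t)\<bar> \<ge> 1/4 \<Longrightarrow> w t - 1/2 \<in> \<int>"
    and k: "k > 0" and f: "profile f"
  defines "g \<equiv> tshear e2 (\<lambda>t. 1/4 * sin (2 * pi * t))"
    and "h \<equiv> tshear e1 f \<circ> tshear e2 (\<lambda>t. 1/4 * sin (2 * pi * t)) \<circ> tshear e1 (\<lambda>t. - f t)"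
  shows "D (g \<circ> h) (h \<circ> g) \<le> 32 * real k * D (tshear e1 (\<lambda>t. w (real k * t))) id"
proof -
  define r where "r = D (tshear e1 (\<lambda>t. w (real k * t))) id"
  define q where "q t = 1 / (32 * real k) * sin (2 * pi * t)" for t
  let ?M = "4 * k"
  let ?p = "tshear e2 (\<lambda>t. 2 * q t)" and ?s = "tshear e1 f" and ?s' = "tshear e1 (\<lambda>t. - f t)"
  have q: "profile q" "q (t + 1/2) = - q t" "\<bar>q t\<bar> \<le> 1 / (32 * real k)" for t
  proof -
    show "profile q" unfolding q_def by (rule profile_scale[OF profile_sin])
    have "2 * pi * (t + 1/2) = 2 * pi * t + pi" by (simp add: algebra_simps)
    then show "q (t + 1/2) = - q t" by (simp add: q_def del: distrib_left_numeral)
    show "\<bar>q t\<bar> \<le> 1 / (32 * real k)"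
      unfolding q_def by (simp add: abs_mult divide_right_mono)
  qed
  \<comment> \<open>The amplitude of \<open>q\<close> is the largest that \<open>fragment\<close>
    permits; \<open>4 k\<close> factors of amplitude \<open>1 / (16 k)\<close> give 1/4.\<close>
  have g: "g = ?p ^^ ?M"
    unfolding g_def tshear_funpow[OF e(2) profile_scale[OF q(1)]]
    by (rule arg_cong[of _ _ "tshear e2"]) (use k in \<open>simp add: q_def fun_eq_iff\<close>)
  have pG: "?p \<in> shear_group" by (simp add: in_group q)
  have sG: "?s \<in> shear_group" "?s' \<in> shear_group" by (simp_all add: in_group f)
  obtain a where a: "a \<in> shear_group" "D ?p a \<le> 2 * r"
    "\<And>z. \<bar>sin (2 * pi * (real k * omega e1 z + 0))\<bar> \<ge> 1/2 \<Longrightarrow> a (torus_proj z) = torus_proj z"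
    unfolding r_def using fragment[where a = 0, OF w q k] by blast
  \<comment> \<open>The phase 1/4 turns the sine into a cosine, so these strips lie in the gaps of
    the first family.\<close>
  obtain b where b: "b \<in> shear_group" "D ?p b \<le> 2 * r"
    "\<And>z. \<bar>sin (2 * pi * (real k * omega e1 z + 1/4))\<bar> \<ge> 1/2 \<Longrightarrow> b (torus_proj z) = torus_proj z"
    unfolding r_def using fragment[where a = "1/4", OF w q k] by blast
  define E where "E = a ^^ ?M"
  define E' where "E' = ?s \<circ> b ^^ ?M \<circ> ?s'"
  have G: "E \<in> shear_group" "E' \<in> shear_group" "g \<in> shear_group" "h \<in> shear_group"
    unfolding E_def E'_def g h_def g_def[symmetric] by (intro shear_group_comp funpow_in a b pG sG)+
  have "D g E \<le> real ?M * D ?p a" unfolding g E_def by (rule dist_funpow[OF pG a(1)])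
  also have "\<dots> \<le> real ?M * (2 * r)" by (intro mult_left_mono a) auto
  finally have DE: "D g E \<le> 8 * real k * r" by simp
  have "D h E' = D g (b ^^ ?M)"
    unfolding h_def g_def[symmetric] E'_def by (intro dist_conj sG G funpow_in b)
  also have "\<dots> \<le> real ?M * D ?p b" unfolding g by (rule dist_funpow[OF pG b(1)])
  also have "\<dots> \<le> real ?M * (2 * r)" by (intro mult_left_mono b) auto
  finally have DE': "D h E' \<le> 8 * real k * r" by simp
  define X where "X p = 2 * pi * (real k * omega e1 (torus_rep p))" for p
  have "E \<circ> E' = E' \<circ> E"
  proof (rule disjoint_support_commute)
    show "inj E" "inj E'" using G shear_group_bij bij_is_inj by blast+
    fix p
    have "a (torus_proj (torus_rep p)) = torus_proj (torus_rep p)" if "p \<notin> {p. \<bar>sin (X p)\<bar> < 1/2}"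
      by (rule a(3)) (use that in \<open>simp add: X_def\<close>)
    then show "E p = p" if "p \<notin> {p. \<bar>sin (X p)\<bar> < 1/2}"
      using that by (simp add: E_def torus_proj_rep funpow_fixpoint)
    show "E' p = p" if "p \<notin> {p. \<bar>cos (X p)\<bar> < 1/2}"
    proof -
      let ?z = "torus_rep p" and ?y = "shear e1 (\<lambda>t. - f t) (torus_rep p)"
      \<comment> \<open>The conjugating shear preserves \<open>omega e1\<close> and with it every
        strip, so conjugation does not enlarge the support.\<close>
      have "2 * pi * (real k * omega e1 ?y + 1/4) = X p + pi / 2" by (simp add: X_def algebra_simps)
      then have "b (torus_proj ?y) = torus_proj ?y"
        by (intro b(3)) (use that in \<open>simp add: sin_add\<close>)
      moreover have "?s' p = torus_proj ?y"
        using tshear_proj[OF e(1) profile_minus[OF f], of ?z] by (simp add: torus_proj_rep)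
      ultimately have "E' p = ?s (?s' p)" by (simp add: E'_def funpow_fixpoint)
      also have "\<dots> = p" using tshear_inverse(1)[OF e(1) f] by (simp add: fun_eq_iff)
      finally show ?thesis .
    qed
  next
    show "{p. \<bar>sin (X p)\<bar> < 1/2} \<inter> {p. \<bar>cos (X p)\<bar> < 1/2} = {}"
    proof -
      have "\<not> (\<bar>sin x\<bar> < 1/2 \<and> \<bar>cos x\<bar> < 1/2)" for x :: real
      proof
        assume "\<bar>sin x\<bar> < 1/2 \<and> \<bar>cos x\<bar> < 1/2"
        then have "(sin x)\<^sup>2 < (1/2)\<^sup>2" "(cos x)\<^sup>2 < (1/2)\<^sup>2"
          using power_strict_mono[of "\<bar>sin x\<bar>" "1/2" 2] power_strict_mono[of "\<bar>cos x\<bar>" "1/2" 2] by simp_all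
        then show False using sin_cos_squared_add[of x] by (simp add: power2_eq_square)
      qed
      then show ?thesis by blast
    qed
  qed
  from dist_commute_approx[OF G(3,4,1,2) this] DE DE' have "D (g \<circ> h) (h \<circ> g) \<le> 32 * (real k * r)"
    by simp
  then show ?thesis by (simp add: r_def)
qed

text \<open>The origin is a fixed point of \<open>g\<close>, and \<open>h\<close> moves it to
  \<open>?u\<close>. If the maps commuted, \<open>g\<close> would fix that point too, but it moves
  it by a quarter of \<open>e2\<close>.\<close>

lemma shears_not_commute:
  defines "g \<equiv> tshear e2 (\<lambda>t. 1/4 * sin (2 * pi * t))"
    and "h \<equiv> tshear e1 (\<lambda>t. 1/4 * cos (2 * pi * t)) \<circ> tshear e2 (\<lambda>t. 1/4 * sin (2 * pi * t)) \<circ>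
      tshear e1 (\<lambda>t. - (1/4 * cos (2 * pi * t)))"
  shows "g \<circ> h \<noteq> h \<circ> g"
proof
  assume eq: "g \<circ> h = h \<circ> g"
  let ?u = "(- (1/4)) *\<^sub>R e1 + (1/4) *\<^sub>R e2"
  note p = profile_scale[OF profile_sin] profile_scale[OF profile_cos] profile_minus[OF profile_scale[OF profile_cos]]
  have trig: "sin (2 * pi * (1/4)) = 1" "cos (2 * pi * (1/4)) = 0" by simp_all
  have g0: "g (torus_proj 0) = torus_proj 0"
    unfolding g_def tshear_proj[OF e(2) p(1)] by (simp add: shear_def omega.zero_right)
  have u: "omega e1 ?u = 1/4" "omega e2 ?u = 1/4" "omega e2 ((- (1/4)) *\<^sub>R e1) = 1/4"
    by (simp_all add: omega.add_right omega.diff_right omega.minus_right omega.scaleR_right e(3) omega21)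
  have "shear e1 (\<lambda>t. - (1/4 * cos (2 * pi * t))) 0 = (- (1/4)) *\<^sub>R e1"
    by (simp add: shear_def omega.zero_right)
  moreover have "shear e2 (\<lambda>t. 1/4 * sin (2 * pi * t)) ((- (1/4)) *\<^sub>R e1) = ?u"
    unfolding shear_def u trig by simp
  moreover have "shear e1 (\<lambda>t. 1/4 * cos (2 * pi * t)) ?u = ?u"
    unfolding shear_def u trig by simp
  ultimately have h0: "h (torus_proj 0) = torus_proj ?u"
    unfolding h_def o_def tshear_proj[OF e(1) p(3)] tshear_proj[OF e(2) p(1)] tshear_proj[OF e(1) p(2)] by simp
  have "g (torus_proj ?u) = torus_proj (?u + (1/4) *\<^sub>R e2)"
    unfolding g_def tshear_proj[OF e(2) p(1)] by (simp only: shear_def u trig mult_1_right)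
  also have "g (torus_proj ?u) = torus_proj ?u"
    using fun_cong[OF eq, of "torus_proj 0"] g0 h0 by simp
  finally have "(1/4) *\<^sub>R e2 \<in> lattice"
    by (metis torus_proj_eq_iff add_diff_cancel_left')
  from omega_lattice[OF e(1) this] have "(1/4 :: real) \<in> \<int>" by (simp add: omega.scaleR_right e(3))
  then show False by (auto simp: Ints_def) (metis of_int_1 of_int_eq_iff of_int_mult of_int_numeral 
        divide_eq_eq zero_neq_numeral mult.commute odd_one even_mult_iff even_numeral)
qed

end

section \<open>Contradiction from a bi-invariant extension\<close>

theorem theorem1p13:
  fixes N :: "('n::finite torus \<Rightarrow> real) \<Rightarrow> real"
  assumes "is_norm N"
    and "chi_invariant N"
    and "nondegenerate_on Ham (finsler_dist N)"
  shows "\<not> extends_biinvariantly Ham Symp0 (finsler_dist N)"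
proof
  assume "extends_biinvariantly Ham Symp0 (finsler_dist N)"
  then obtain D where "biinvariant_metric Symp0 D" and D: "\<And>f g. f \<in> Ham \<Longrightarrow> g \<in> Ham \<Longrightarrow> D f g = finsler_dist N f g"
    unfolding extends_biinvariantly_def by blast
  then have met: "Metric_space Symp0 D" and inv: "\<And>f g h. f \<in> Symp0 \<Longrightarrow> g \<in> Symp0 \<Longrightarrow> h \<in> Symp0 \<Longrightarrow>
      D (h \<circ> f) (h \<circ> g) = D f g \<and> D (f \<circ> h) (g \<circ> h) = D f g"
    unfolding biinvariant_metric_def by blast+
  define i :: 'n where "i = undefined"
  define e1 :: "'n phase_space" where "e1 = (axis i 1, 0)"
  define e2 :: "'n phase_space" where "e2 = (0, axis i 1)"
  have sub: "shear_group \<subseteq> (Symp0 :: ('n torus \<Rightarrow> 'n torus) set)" using shear_group_Symp0 by blast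
  interpret shear_metric D e1 e2
  proof (intro shear_metric.intro biinvariant_group.intro shear_metric_axioms.intro)
    show "Metric_space shear_group D" by (rule Metric_space.subspace[OF met sub])
    show "e1 \<in> lattice" "e2 \<in> lattice"
      by (auto simp: e1_def e2_def lattice_iff axis_def)
    have "omega e1 e2 = (\<Sum>j\<in>UNIV. if j = i then 1 else 0)"
      unfolding omega_def by (intro sum.cong) (auto simp: e1_def e2_def axis_def)
    then show "omega e1 e2 = 1" by simp
  qed (use inv sub in \<open>auto intro: shear_group_comp shear_group.id\<close>)
  interpret M: Metric_space shear_group D by (rule metric)
  obtain w where w: "profile w" "\<And>t. w (t + 1/2) = - w t"
    "\<And>t. \<bar>sin (2 * pi * t)\<bar> \<ge> 1/4 \<Longrightarrow> w t - 1/2 \<in> \<int>"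
    by (rule antiperiodic_step) blast
  \<comment> \<open>Half of \<open>w\<close>, because the commutator in
    \<open>covering_defect_le\<close> doubles the profile.\<close>
  define v where "v t = 1/2 * w t" for t
  have v: "profile v" "\<And>t. v (t + 1/2) = - v t"
    unfolding v_def by (rule profile_scale[OF w(1)]) (simp add: w(2))
  obtain V where V: "profile V" "\<And>t. (V has_real_derivative v t) (at t)"
    by (rule antiperiodic_antiderivative[OF v]) blast
  \<comment> \<open>By \<open>shear_defect_le\<close> this bounds the shears of profile
    \<open>k v\<close> for all \<open>k\<close> at once; the summand 1 makes the bound
    strict.\<close>
  define L where "L = 2 * D (tshear e2 (\<lambda>_. 1/2)) id + 1"
  have small: "D (tshear e1 (\<lambda>t. w (real k * t))) id \<le> 2 * (L / real k ^ 2)" if k: "k > 0" for k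
  proof -
    \<comment> \<open>The amplitude \<open>k\<close> compensates the division by \<open>k\<close> in
      the lifted map, which becomes the shear of profile \<open>v (k t)\<close> up to a deck
      translation.\<close>
    let ?f = "\<lambda>t. real k * v t"
    have dV: "((\<lambda>t. real k * V t) has_real_derivative ?f t) (at t)" for t
      by (rule DERIV_cmult[OF V(2)])
    obtain F \<alpha> where F: "admissible N F \<alpha>" "\<alpha> 0 = id" "\<alpha> 1 = tshear e1 ?f"
      by (rule autonomous_shear_path[OF e(1) profile_scale[OF V(1)] dV profile_scale[OF v(1)]])
    \<comment> \<open>The identity and this shear are endpoints of an admissible path, hence
      Hamiltonian, and between them \<open>D\<close> is the Finsler distance.\<close>
    have "\<alpha> t \<in> Ham" if "t \<in> {0..1}" for t using F(1) that by (simp add: admissible_def)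
    from this[of 0] this[of 1] have Ham: "(id :: 'n torus \<Rightarrow> _) \<in> Ham" "tshear e1 ?f \<in> Ham"
      unfolding F(2,3) by simp_all
    have smooth: "smooth ?f" using profile_scale[OF v(1)] unfolding profile_def by blast
    have "D id (tshear e1 ?f) < L"
      using shear_defect_le[OF v, of "real k"] k by (simp add: L_def)
    then have "finsler_dist N id (tshear e1 ?f) < L" using D Ham by simp
    note cov = finsler_covering[OF assms(1,2) F this smooth_continuous[OF smooth_shear[OF smooth]]
        tshear_proj[OF e(1) profile_scale[OF v(1)]] k]
    obtain h l where h: "h \<in> Ham" "l \<in> lattice"
      "\<And>z. h (torus_proj z) = torus_proj (inverse (real k) *\<^sub>R (shear e1 ?f (real k *\<^sub>R z) + l))"
      "finsler_dist N id h \<le> L / real k ^ 2"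
      using cov by blast
    note c = covering_defect_le[OF v k h(2,3)]
    have "D h id \<le> L / real k ^ 2"
      using h(4) D[OF Ham(1) h(1)] by (simp add: M.commute)
    with c(2) show ?thesis by (simp add: v_def)
  qed
  define g where "g = tshear e2 (\<lambda>t. 1/4 * sin (2 * pi * t))"
  define h where "h = tshear e1 (\<lambda>t. 1/4 * cos (2 * pi * t)) \<circ> g \<circ> tshear e1 (\<lambda>t. - (1/4 * cos (2 * pi * t)))"
  have G: "g \<in> shear_group" "h \<in> shear_group"
    unfolding g_def h_def by (intro shear_group_comp shear_group_tshear e profile_minus profile_scale profile_sin profile_cos)+
  have "D (g \<circ> h) (h \<circ> g) \<le> 64 * L / real k" if k: "k > 0" for k
  proof -
    have "D (g \<circ> h) (h \<circ> g) \<le> 32 * real k * D (tshear e1 (\<lambda>t. w (real k * t))) id"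
      using shears_commute_approx[OF w(1,3) k profile_scale[OF profile_cos]] unfolding g_def h_def .
    also have "\<dots> \<le> 32 * real k * (2 * (L / real k ^ 2))" by (intro mult_left_mono small k) auto
    also have "\<dots> = 64 * L / real k" using k by (simp add: power2_eq_square)
    finally show ?thesis .
  qed
  \<comment> \<open>The \<open>4 k\<close> factors are outweighed by the gain \<open>1 / k^2\<close>
    of the covering, and \<open>k\<close> tends to infinity.\<close>
  then have "D (g \<circ> h) (h \<circ> g) \<le> 0"
    using lim_const_over_n[of "64 * L"]
    by (intro LIMSEQ_le_const) (auto intro!: exI[of _ 1])
  then have "g \<circ> h = h \<circ> g"
    using M.zero[of "g \<circ> h" "h \<circ> g"] M.nonneg[of "g \<circ> h" "h \<circ> g"] G by (simp add: shear_group_comp)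
  then show False
    using shears_not_commute unfolding g_def h_def by blast
qed

end
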